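(* The only quadric surfaces in the 3-dimensional Euclidean space $E^{3}$ whose position vector $\boldsymbol{x}$ satisfies the relation $$\Delta^{III}\boldsymbol{x}=\Lambda\boldsymbol{x},$$ where $\Lambda$ is a (constant, real) square matrix of order $3$, are the spheres.
   Context: Surfaces $S$ in $E^{3}$ are connected and contain no parabolic points (the Gauss curvature vanishes nowhere). Let $u^{1},u^{2}$ be local coordinates on $S$, $\boldsymbol{x}=\boldsymbol{x}(u^{1},u^{2})$ its position vector and $\boldsymbol{n}$ its Gauss map (unit normal). The third fundamental form of $S$ is $III=\langle d\boldsymbol{n},d\boldsymbol{n}\rangle=e_{ij}\,du^{i}du^{j}$; $(e^{ij})$ denotes the inverse of $(e_{ij})$ and $e=\det(e_{ij})$. The Beltrami operator with respect to $III$ is, for a sufficiently differentiable function $\varphi$ on $S$, $$\Delta^{III}\varphi=-\frac{1}{\sqrt{e}}\,\frac{\partial}{\partial u^{j}}\!\left(\sqrt{e}\,e^{ij}\,\frac{\partial\varphi}{\partial u^{i}}\right)$$ (summation over $i,j\in\{1,2\}$), with the sign convention $\Delta=-\partial_x^2-\partial_y^2$ for the metric $dx^2+dy^2$. It acts on the vector-valued function $\boldsymbol{x}$ componentwise in Cartesian coordinates of $E^{3}$. A quadric surface is a surface in $E^{3}$ given by a polynomial equation of degree $2$ in the Cartesian coordinates. The matrix $\Lambda$ is not prescribed: a surface satisfies the relation if it does so for some $\Lambda$. The discussion is local: quadric surfaces and spheres may be replaced by open parts of them.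
   Formalization: "The spheres" is made precise as open parts of spheres centred at the origin: for a sphere with centre c one has Δ^III x = 2(x − c), which is of the form Λx only if c = 0, so spheres with another centre do not satisfy the relation. *)

theory Defs
  imports "HOL-Analysis.Analysis"
begin

definition partial_deriv :: "2 \<Rightarrow> (real^2 \<Rightarrow> 'b::real_normed_vector) \<Rightarrow> real^2 \<Rightarrow> 'b" where
  "partial_deriv i f u = frechet_derivative f (at u) (axis i 1)"

primrec Ck_on :: "nat \<Rightarrow> (real^2) set \<Rightarrow> (real^2 \<Rightarrow> 'b::real_normed_vector) \<Rightarrow> bool" where
  "Ck_on 0 U f \<longleftrightarrow> continuous_on U f"
| "Ck_on (Suc k) U f \<longleftrightarrow> f differentiable_on U \<and> (\<forall>i. Ck_on k U (partial_deriv i f))"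

definition smooth_on :: "(real^2) set \<Rightarrow> (real^2 \<Rightarrow> 'b::real_normed_vector) \<Rightarrow> bool" where
  "smooth_on U f \<longleftrightarrow> (\<forall>k. Ck_on k U f)"

definition tangent_cross :: "(real^2 \<Rightarrow> real^3) \<Rightarrow> real^2 \<Rightarrow> real^3" where
  "tangent_cross x u = cross3 (partial_deriv 1 x u) (partial_deriv 2 x u)"

definition local_param :: "(real^3) set \<Rightarrow> (real^2) set \<Rightarrow> (real^2 \<Rightarrow> real^3) \<Rightarrow> bool" where
  "local_param S U x \<longleftrightarrow>
     open U \<and> openin (top_of_set S) (x ` U) \<and> smooth_on U x \<and>
     (\<exists>y. homeomorphism U (x ` U) x y) \<and> (\<forall>u\<in>U. tangent_cross x u \<noteq> 0)"

definition regular_surface :: "(real^3) set \<Rightarrow> bool" where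
  "regular_surface S \<longleftrightarrow> S \<noteq> {} \<and> (\<forall>p\<in>S. \<exists>U x. local_param S U x \<and> p \<in> x ` U)"

text \<open>Reversing the unit normal changes neither the third fundamental form nor the Gauss
  curvature, so no orientation of \<open>S\<close> is needed.\<close>

definition gauss_map :: "(real^2 \<Rightarrow> real^3) \<Rightarrow> real^2 \<Rightarrow> real^3" where
  "gauss_map x u = tangent_cross x u /\<^sub>R norm (tangent_cross x u)"

definition first_form :: "(real^2 \<Rightarrow> real^3) \<Rightarrow> real^2 \<Rightarrow> real^2^2" where
  "first_form x u = (\<chi> i j. partial_deriv i x u \<bullet> partial_deriv j x u)"

definition second_form :: "(real^2 \<Rightarrow> real^3) \<Rightarrow> real^2 \<Rightarrow> real^2^2" where
  "second_form x u = (\<chi> i j. partial_deriv i (partial_deriv j x) u \<bullet> gauss_map x u)"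

definition third_form :: "(real^2 \<Rightarrow> real^3) \<Rightarrow> real^2 \<Rightarrow> real^2^2" where
  "third_form x u = (\<chi> i j. partial_deriv i (gauss_map x) u \<bullet> partial_deriv j (gauss_map x) u)"

definition gauss_curvature :: "(real^2 \<Rightarrow> real^3) \<Rightarrow> real^2 \<Rightarrow> real" where
  "gauss_curvature x u = det (second_form x u) / det (first_form x u)"

definition no_parabolic_points :: "(real^3) set \<Rightarrow> bool" where
  "no_parabolic_points S \<longleftrightarrow> (\<forall>U x. local_param S U x \<longrightarrow> (\<forall>u\<in>U. gauss_curvature x u \<noteq> 0))"

definition beltrami_III :: "(real^2 \<Rightarrow> real^3) \<Rightarrow> (real^2 \<Rightarrow> real) \<Rightarrow> real^2 \<Rightarrow> real" where
  "beltrami_III x \<phi> u =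
     - (1 / sqrt (det (third_form x u))) *
       (\<Sum>j\<in>UNIV. partial_deriv j
          (\<lambda>v. \<Sum>i\<in>UNIV. sqrt (det (third_form x v)) * matrix_inv (third_form x v) $ i $ j
                          * partial_deriv i \<phi> v) u)"

definition beltrami_III_vec ::
    "(real^2 \<Rightarrow> real^3) \<Rightarrow> (real^2 \<Rightarrow> real^3) \<Rightarrow> real^2 \<Rightarrow> real^3" where
  "beltrami_III_vec x f u = (\<chi> k. beltrami_III x (\<lambda>v. f v $ k) u)"

definition satisfies_III_relation :: "(real^3) set \<Rightarrow> real^3^3 \<Rightarrow> bool" where
  "satisfies_III_relation S \<Lambda> \<longleftrightarrow>
     (\<forall>U x. local_param S U x \<longrightarrow> (\<forall>u\<in>U. beltrami_III_vec x x u = \<Lambda> *v x u))"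

text \<open>Every real polynomial of degree 2 in three variables is
  \<open>p \<bullet> (A *v p) + b \<bullet> p + c\<close> for a unique nonzero symmetric \<open>A\<close> and unique \<open>b\<close>, \<open>c\<close>.
  Symmetry is needed for \<open>A \<noteq> 0\<close> to express that the degree is exactly 2.\<close>

definition quadric :: "(real^3) set \<Rightarrow> bool" where
  "quadric Q \<longleftrightarrow>
     (\<exists>A b c. transpose A = A \<and> A \<noteq> 0 \<and> Q = {p. p \<bullet> (A *v p) + b \<bullet> p + c = 0})"

abbreviation open_part :: "'a::topological_space set \<Rightarrow> 'a set \<Rightarrow> bool" where
  "open_part S T \<equiv> openin (top_of_set T) S"

end

theory Submission
  imports Defs
begin

text \<open>
  Write \<open>n\<close> for the Gauss map, \<open>e\<close> for the third fundamental form and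
  \<open>W\<^sup>j = \<surd>e e\<^sup>i\<^sup>j \<partial>\<^sub>i x\<close>, so that \<open>- \<surd>e\<close> times the Beltrami operator of \<open>x\<close> is \<open>\<partial>\<^sub>j W\<^sup>j\<close>.
  On a sphere about the origin \<open>n\<close> is proportional to \<open>x\<close>, whence \<open>W\<^sup>1 = \<partial>\<^sub>2 x \<times> n\<close>,
  \<open>W\<^sup>2 = n \<times> \<partial>\<^sub>1 x\<close>, and the symmetry of mixed derivatives gives \<open>2 x\<close>.

  Conversely only the normal component of the relation is used: as \<open>W\<^sup>j\<close> is tangential,
  \<open>\<partial>\<^sub>j W\<^sup>j \<bullet> n = - W\<^sup>j \<bullet> \<partial>\<^sub>j n\<close>, the sum of the principal radii up to a factor. For the quadric with
  matrix \<open>A\<close> and half-gradient \<open>N = A p + b / 2\<close> this reads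
  \<open>(N \<bullet> adj A N) (\<Lambda> p \<bullet> N) = |N|\<^sup>2 (N \<bullet> (tr A - A) N)\<close>.
  If \<open>A\<close> is singular, the quadric is a paraboloid and the two sides have different degrees.
  Otherwise \<open>N \<bullet> A\<^sup>-\<^sup>1 N\<close> is constant, and homogenising with it gives a polynomial identity in \<open>N\<close>, whose value
  at the complex isotropic vectors \<open>e\<^sub>i + t e\<^sub>j\<close> of \<open>A\<^sup>-\<^sup>1\<close>, for eigenvectors \<open>e\<^sub>i\<close>, \<open>e\<^sub>j\<close>, forces equal eigenvalues.
  The identity that remains for a sphere forces its centre to be the origin.
\<close>

subsection \<open>Partial derivatives\<close>

lemma partial_deriv_eq:
  "(f has_derivative f') (at u) \<Longrightarrow> partial_deriv i f u = f' (axis i 1)"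
  unfolding partial_deriv_def by (metis frechet_derivative_at)

text \<open>\<open>frechet_derivative\<close> chooses some derivative, so agreement near
  \<open>u\<close> suffices even without differentiability: both functions have the same set of
  derivatives there.\<close>

lemma partial_deriv_cong:
  assumes "open U" "u \<in> U" "\<And>v. v \<in> U \<Longrightarrow> f v = g v"
  shows "partial_deriv i f u = partial_deriv i g u"
proof -
  have "(f has_derivative f') (at u) \<longleftrightarrow> (g has_derivative f') (at u)" for f'
    using assms has_derivative_transform_within_open[of _ _ u UNIV U]
    by (metis)
  then show ?thesis
    by (simp add: partial_deriv_def frechet_derivative_def)
qed

lemma differentiable_cong_open:
  assumes "open U" "u \<in> U" "\<And>v. v \<in> U \<Longrightarrow> f v = g v" "g differentiable (at u)"
  shows "f differentiable (at u)"
  using assms has_derivative_transform_within_open[of g _ u UNIV U f]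
  unfolding differentiable_def by metis

lemma partial_deriv_const [simp]: "partial_deriv i (\<lambda>_. c) u = 0"
  by (subst partial_deriv_eq[OF has_derivative_const]) simp

lemma partial_deriv_linear:
  assumes "bounded_linear L" "f differentiable (at u)"
  shows "partial_deriv i (\<lambda>v. L (f v)) u = L (partial_deriv i f u)"
proof -
  have "(f has_derivative frechet_derivative f (at u)) (at u)"
    using assms(2) frechet_derivative_works by blast
  from partial_deriv_eq[OF bounded_linear.has_derivative[OF assms(1) this]]
  show ?thesis by (simp add: partial_deriv_def)
qed

lemma partial_deriv_add:
  assumes "f differentiable (at u)" "g differentiable (at u)"
  shows "partial_deriv i (\<lambda>v. f v + g v) u = partial_deriv i f u + partial_deriv i g u"
proof -
  have "(f has_derivative frechet_derivative f (at u)) (at u)"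
    "(g has_derivative frechet_derivative g (at u)) (at u)"
    using assms frechet_derivative_works by blast+
  from partial_deriv_eq[OF has_derivative_add[OF this]]
  show ?thesis by (simp add: partial_deriv_def)
qed

lemma partial_deriv_bilinear:
  assumes "bounded_bilinear B" "f differentiable (at u)" "g differentiable (at u)"
  shows "partial_deriv i (\<lambda>v. B (f v) (g v)) u = B (f u) (partial_deriv i g u) + B (partial_deriv i f u) (g u)"
proof -
  have "(f has_derivative frechet_derivative f (at u)) (at u)"
    "(g has_derivative frechet_derivative g (at u)) (at u)"
    using assms frechet_derivative_works by blast+
  from partial_deriv_eq[OF bounded_bilinear.FDERIV[OF assms(1) this]]
  show ?thesis by (simp add: partial_deriv_def)
qed

lemma differentiable_bilinear:
  assumes "bounded_bilinear B" "f differentiable (at u)" "g differentiable (at u)"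
  shows "(\<lambda>v. B (f v) (g v)) differentiable (at u)"
  using assms bounded_bilinear.FDERIV[OF assms(1)] unfolding differentiable_def by blast

lemma bounded_bilinear_cross3: "bounded_bilinear cross3"
  using bilinear_cross bilinear_conv_bounded_bilinear by blast

lemmas partial_deriv_inner = partial_deriv_bilinear[OF bounded_bilinear_inner]
lemmas partial_deriv_cross3 = partial_deriv_bilinear[OF bounded_bilinear_cross3]
lemmas partial_deriv_scaleR = partial_deriv_bilinear[OF bounded_bilinear_scaleR]
lemmas differentiable_inner = differentiable_bilinear[OF bounded_bilinear_inner]
lemmas differentiable_cross3 = differentiable_bilinear[OF bounded_bilinear_cross3]

lemma smooth_onD:
  assumes "smooth_on U f" "open U" "u \<in> U"
  shows "f differentiable (at u)" "smooth_on U (partial_deriv i f)"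
proof -
  have *: "Ck_on (Suc k) U f" for k
    using assms(1) smooth_on_def by blast
  show "f differentiable (at u)"
    using *[of 0] assms(2,3) by (simp add: differentiable_on_eq_differentiable_at)
  show "smooth_on U (partial_deriv i f)"
    using * by (simp add: smooth_on_def)
qed

text \<open>Both mixed derivatives are the limit of the same symmetric second difference quotient.\<close>

lemma second_difference_bound:
  fixes f :: "real^2 \<Rightarrow> real"
  assumes U: "open U" "u \<in> U" and f: "\<And>v. v \<in> U \<Longrightarrow> f differentiable (at v)"
    and d: "(partial_deriv i f) differentiable (at u)" and "\<epsilon> > 0"
  shows "\<exists>\<delta>>0. \<forall>h. 0 < h \<and> h < \<delta> \<longrightarrow>
     \<bar>f (u + h *\<^sub>R axis i 1 + h *\<^sub>R axis j 1) - f (u + h *\<^sub>R axis i 1) - f (u + h *\<^sub>R axis j 1) + f u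
      - h^2 * partial_deriv j (partial_deriv i f) u\<bar> \<le> \<epsilon> * h^2"
proof -
  define F where "F = partial_deriv i f"
  define F' where "F' = frechet_derivative F (at u)"
  have F': "(F has_derivative F') (at u)"
    using d unfolding F_def F'_def by (simp add: frechet_derivative_works)
  then interpret F': bounded_linear F' by (rule has_derivative_bounded_linear)
  obtain e where e: "e > 0" "ball u e \<subseteq> U"
    using U open_contains_ball by blast
  \<comment> \<open>A third of the error suffices: the remainders of \<open>F\<close> below are
    taken at distances at most \<open>2 * h\<close> and \<open>h\<close>.\<close>
  obtain d where d: "d > 0"
    "\<And>v. norm (v - u) < d \<Longrightarrow> norm (F v - F u - F' (v - u)) \<le> (\<epsilon>/3) * norm (v - u)"
    using F' \<open>\<epsilon> > 0\<close> unfolding has_derivative_at_alt by (metis zero_less_divide_iff zero_less_numeral)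
  show ?thesis
  proof (intro exI[of _ "min d e / 2"] conjI allI impI)
    show "0 < min d e / 2" using d e by simp
    fix h assume h: "0 < h \<and> h < min d e / 2"
    let ?a = "axis i 1 :: real^2" and ?b = "axis j 1 :: real^2"
    have small: "norm (s *\<^sub>R ?a + t *\<^sub>R ?b) \<le> s + t" if "0 \<le> s" "0 \<le> t" for s t
      using norm_triangle_ineq[of "s *\<^sub>R ?a" "t *\<^sub>R ?b"] that by simp
    have inU: "u + s *\<^sub>R ?a + t *\<^sub>R ?b \<in> U" if "0 \<le> s" "s \<le> h" "0 \<le> t" "t \<le> h" for s t
    proof -
      have "dist (u + (s *\<^sub>R ?a + t *\<^sub>R ?b)) u < e"
        using small[of s t] that h by (simp add: dist_norm)
      then show ?thesis using e(2) by (auto simp: add.assoc dist_commute)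
    qed
    define \<phi> where "\<phi> s = f (u + s *\<^sub>R ?a + h *\<^sub>R ?b) - f (u + s *\<^sub>R ?a)" for s
    have der: "((\<lambda>s. f (u + s *\<^sub>R ?a + t *\<^sub>R ?b)) has_real_derivative F (u + s *\<^sub>R ?a + t *\<^sub>R ?b)) (at s)"
      if "0 \<le> s" "s \<le> h" "0 \<le> t" "t \<le> h" for s t
    proof -
      let ?p = "u + s *\<^sub>R ?a + t *\<^sub>R ?b"
      have "(f has_derivative frechet_derivative f (at ?p)) (at ?p)"
        using f[OF inU[OF that]] frechet_derivative_works by blast
      moreover have "((\<lambda>s. u + s *\<^sub>R ?a + t *\<^sub>R ?b) has_derivative (\<lambda>s. s *\<^sub>R ?a)) (at s)"
        by (auto intro!: derivative_eq_intros)
      ultimately have "((\<lambda>s. f (u + s *\<^sub>R ?a + t *\<^sub>R ?b)) has_derivative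
          (\<lambda>s. frechet_derivative f (at ?p) (s *\<^sub>R ?a))) (at s)"
        using has_derivative_compose by fastforce
      moreover have "frechet_derivative f (at ?p) (c *\<^sub>R ?a) = F ?p * c" for c
        using linear_frechet_derivative[OF f[OF inU[OF that]]]
        by (simp add: F_def partial_deriv_def linear_cmul)
      ultimately show ?thesis
        unfolding has_field_derivative_def by simp
    qed
    \<comment> \<open>The second difference is \<open>\<phi> h - \<phi> 0\<close>. The mean value
      theorem makes it a first difference of \<open>F\<close> in direction \<open>j\<close>, whose
      common offset \<open>z\<close> cancels in the linear approximation.\<close>
    have "\<exists>z>0. z < h \<and> \<phi> h - \<phi> 0 = (h - 0) * (F (u + z *\<^sub>R ?a + h *\<^sub>R ?b) - F (u + z *\<^sub>R ?a))"
    proof (rule MVT2)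
      fix s assume "0 \<le> s" "s \<le> h"
      then show "(\<phi> has_real_derivative F (u + s *\<^sub>R ?a + h *\<^sub>R ?b) - F (u + s *\<^sub>R ?a)) (at s)"
        unfolding \<phi>_def using der[of s h] der[of s 0] h by (intro DERIV_diff) auto
    qed (use h in auto)
    then obtain z where z: "0 < z" "z < h"
      "\<phi> h - \<phi> 0 = h * (F (u + z *\<^sub>R ?a + h *\<^sub>R ?b) - F (u + z *\<^sub>R ?a))" by auto
    have n1: "norm (z *\<^sub>R ?a + h *\<^sub>R ?b) \<le> 2 * h" "norm (z *\<^sub>R ?a) \<le> h"
      using small[of z h] small[of z 0] z h by auto
    have "norm (F (u + (z *\<^sub>R ?a + h *\<^sub>R ?b)) - F u - F' (z *\<^sub>R ?a + h *\<^sub>R ?b)) \<le> (\<epsilon>/3) * norm (z *\<^sub>R ?a + h *\<^sub>R ?b)"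
      using d(2)[of "u + (z *\<^sub>R ?a + h *\<^sub>R ?b)"] n1 h by simp
    also have "\<dots> \<le> (\<epsilon>/3) * (2 * h)" using n1 \<open>\<epsilon> > 0\<close> by (intro mult_left_mono) auto
    finally have A: "\<bar>F (u + z *\<^sub>R ?a + h *\<^sub>R ?b) - F u - (z * F' ?a + h * F' ?b)\<bar> \<le> (\<epsilon>/3) * (2 * h)"
      by (simp add: F'.add F'.scaleR add.assoc)
    have "norm (F (u + z *\<^sub>R ?a) - F u - F' (z *\<^sub>R ?a)) \<le> (\<epsilon>/3) * norm (z *\<^sub>R ?a)"
      using d(2)[of "u + z *\<^sub>R ?a"] n1 h by simp
    also have "\<dots> \<le> (\<epsilon>/3) * h" using n1 \<open>\<epsilon> > 0\<close> by (intro mult_left_mono) auto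
    finally have B: "\<bar>F (u + z *\<^sub>R ?a) - F u - z * F' ?a\<bar> \<le> (\<epsilon>/3) * h"
      by (simp add: F'.scaleR)
    from A B have "\<bar>(F (u + z *\<^sub>R ?a + h *\<^sub>R ?b) - F (u + z *\<^sub>R ?a)) - h * F' ?b\<bar> \<le> \<epsilon> * h"
      by argo
    then have "h * \<bar>(F (u + z *\<^sub>R ?a + h *\<^sub>R ?b) - F (u + z *\<^sub>R ?a)) - h * F' ?b\<bar> \<le> h * (\<epsilon> * h)"
      using h by (intro mult_left_mono) auto
    also have "h * \<bar>(F (u + z *\<^sub>R ?a + h *\<^sub>R ?b) - F (u + z *\<^sub>R ?a)) - h * F' ?b\<bar>
       = \<bar>h * ((F (u + z *\<^sub>R ?a + h *\<^sub>R ?b) - F (u + z *\<^sub>R ?a)) - h * F' ?b)\<bar>"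
      using h by (simp add: abs_mult)
    also have "h * ((F (u + z *\<^sub>R ?a + h *\<^sub>R ?b) - F (u + z *\<^sub>R ?a)) - h * F' ?b) = \<phi> h - \<phi> 0 - h^2 * F' ?b"
      using z(3) by (simp add: algebra_simps power2_eq_square)
    also have "F' ?b = partial_deriv j (partial_deriv i f) u"
      by (simp add: F'_def F_def partial_deriv_def)
    finally show "\<bar>f (u + h *\<^sub>R ?a + h *\<^sub>R ?b) - f (u + h *\<^sub>R ?a) - f (u + h *\<^sub>R ?b) + f u
      - h^2 * partial_deriv j (partial_deriv i f) u\<bar> \<le> \<epsilon> * h^2"
      unfolding \<phi>_def by (simp add: power2_eq_square algebra_simps)
  qed
qed

lemma partial_deriv_commute_real:
  fixes f :: "real^2 \<Rightarrow> real"
  assumes U: "open U" "u \<in> U" and f: "\<And>v. v \<in> U \<Longrightarrow> f differentiable (at v)"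
    and d: "\<And>i. (partial_deriv i f) differentiable (at u)"
  shows "partial_deriv j (partial_deriv i f) u = partial_deriv i (partial_deriv j f) u"
proof (rule ccontr)
  let ?x = "partial_deriv j (partial_deriv i f) u" and ?y = "partial_deriv i (partial_deriv j f) u"
  assume "?x \<noteq> ?y"
  \<comment> \<open>With a third of the gap each, the two errors together cover only two thirds of
    it.\<close>
  then have e: "\<bar>?x - ?y\<bar> / 3 > 0" by simp
  obtain d1 where d1: "d1 > 0" "\<And>h. 0 < h \<and> h < d1 \<Longrightarrow>
     \<bar>f (u + h *\<^sub>R axis i 1 + h *\<^sub>R axis j 1) - f (u + h *\<^sub>R axis i 1) - f (u + h *\<^sub>R axis j 1) + f u
      - h^2 * ?x\<bar> \<le> (\<bar>?x - ?y\<bar> / 3) * h^2"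
    using second_difference_bound[OF U f d e] by metis
  obtain d2 where d2: "d2 > 0" "\<And>h. 0 < h \<and> h < d2 \<Longrightarrow>
     \<bar>f (u + h *\<^sub>R axis j 1 + h *\<^sub>R axis i 1) - f (u + h *\<^sub>R axis j 1) - f (u + h *\<^sub>R axis i 1) + f u
      - h^2 * ?y\<bar> \<le> (\<bar>?x - ?y\<bar> / 3) * h^2"
    using second_difference_bound[OF U f d e] by metis
  define h where "h = min d1 d2 / 2"
  have h: "0 < h" "h < d1" "h < d2" using d1(1) d2(1) by (auto simp: h_def)
  have eq: "u + h *\<^sub>R axis j 1 + h *\<^sub>R axis i 1 = u + h *\<^sub>R axis i 1 + h *\<^sub>R axis j 1"
    by (simp add: algebra_simps)
  have "\<bar>h^2 * ?x - h^2 * ?y\<bar> \<le> 2 * ((\<bar>?x - ?y\<bar> / 3) * h^2)"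
    using d1(2)[of h] d2(2)[of h] h unfolding eq by linarith
  then have "h^2 * \<bar>?x - ?y\<bar> \<le> h^2 * (2/3 * \<bar>?x - ?y\<bar>)"
    by (simp add: right_diff_distrib[symmetric] abs_mult)
  then have "\<bar>?x - ?y\<bar> \<le> 2/3 * \<bar>?x - ?y\<bar>"
    using h by simp
  then show False using \<open>?x \<noteq> ?y\<close> by simp
qed

lemma partial_deriv_commute:
  fixes f :: "real^2 \<Rightarrow> 'a::euclidean_space"
  assumes U: "open U" "u \<in> U" and f: "\<And>v. v \<in> U \<Longrightarrow> f differentiable (at v)"
    and d: "\<And>i v. v \<in> U \<Longrightarrow> (partial_deriv i f) differentiable (at v)"
  shows "partial_deriv j (partial_deriv i f) u = partial_deriv i (partial_deriv j f) u"
proof (rule euclidean_eqI)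
  fix b :: 'a
  have L: "bounded_linear (\<lambda>y. y \<bullet> b)" by (rule bounded_linear_inner_left)
  have 1: "partial_deriv i (\<lambda>v. f v \<bullet> b) v = partial_deriv i f v \<bullet> b" if "v \<in> U" for i v
    using partial_deriv_linear[OF L f[OF that]] .
  have 2: "partial_deriv j (partial_deriv i (\<lambda>v. f v \<bullet> b)) u = partial_deriv j (partial_deriv i f) u \<bullet> b" for i j
    by (subst partial_deriv_cong[OF U 1]) (simp_all add: partial_deriv_linear[OF L d[OF U(2)]])
  have "partial_deriv i (\<lambda>v. f v \<bullet> b) differentiable (at u)" for i
    by (rule differentiable_cong_open[OF U 1])
      (simp_all add: differentiable_inner d U)
  moreover have "(\<lambda>v. f v \<bullet> b) differentiable (at v)" if "v \<in> U" for v
    using differentiable_inner[OF f[OF that], of "\<lambda>_. b"] by simp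
  ultimately show "partial_deriv j (partial_deriv i f) u \<bullet> b = partial_deriv i (partial_deriv j f) u \<bullet> b"
    using partial_deriv_commute_real[OF U, where f = "\<lambda>v. f v \<bullet> b"] by (simp add: 2)
qed

subsection \<open>The Gauss map of a surface patch\<close>

lemma differentiable_inverse_norm:
  fixes F :: "'a::real_normed_vector \<Rightarrow> 'b::real_inner"
  assumes "F differentiable (at u)" "F u \<noteq> 0"
  shows "(\<lambda>v. inverse (norm (F v))) differentiable (at u)"
proof -
  have "(norm \<circ> F) differentiable (at u)"
    using assms by (intro differentiable_chain_at differentiable_norm_at)
  then show ?thesis
    using assms(2) by (intro differentiable_inverse) (auto simp: o_def)
qed

text \<open>The derivative of the factor is read off from the constant squared length of the
  normalised \<open>F\<close>.\<close>

lemma partial_deriv_inverse_norm: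
  fixes F :: "real^2 \<Rightarrow> 'b::real_inner"
  assumes U: "open U" "u \<in> U" and F: "F differentiable (at u)" and nz: "\<And>v. v \<in> U \<Longrightarrow> F v \<noteq> 0"
  shows "partial_deriv i (\<lambda>v. inverse (norm (F v))) u
    = - (inverse (norm (F u))^3) * (F u \<bullet> partial_deriv i F u)"
proof -
  let ?s = "\<lambda>v. inverse (norm (F v))"
  have s: "?s differentiable (at u)" by (rule differentiable_inverse_norm[OF F nz[OF U(2)]])
  have G: "(\<lambda>v. ?s v *\<^sub>R F v) differentiable (at u)"
    by (rule differentiable_bilinear[OF bounded_bilinear_scaleR s F])
  have "0 = partial_deriv i (\<lambda>_. 1::real) u" by simp
  also have "\<dots> = partial_deriv i (\<lambda>v. (?s v *\<^sub>R F v) \<bullet> (?s v *\<^sub>R F v)) u"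
    by (rule partial_deriv_cong[OF U]) (simp add: dot_square_norm nz power2_eq_square)
  also have "\<dots> = 2 * (?s u *\<^sub>R F u \<bullet> partial_deriv i (\<lambda>v. ?s v *\<^sub>R F v) u)"
    by (subst partial_deriv_inner[OF G G]) (simp add: inner_commute)
  also have "partial_deriv i (\<lambda>v. ?s v *\<^sub>R F v) u = ?s u *\<^sub>R partial_deriv i F u + partial_deriv i ?s u *\<^sub>R F u"
    by (rule partial_deriv_scaleR[OF s F])
  finally have "0 = 2 * ?s u * (?s u * (F u \<bullet> partial_deriv i F u) + partial_deriv i ?s u * (norm (F u))^2)"
    by (simp add: inner_add_right dot_square_norm algebra_simps)
  then have "?s u * (F u \<bullet> partial_deriv i F u) + partial_deriv i ?s u * (norm (F u))^2 = 0"
    using nz[OF U(2)] by simp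
  then show ?thesis
    using nz[OF U(2)] by (simp add: field_simps power2_eq_square power3_eq_cube)
qed

locale surface_patch =
  fixes U :: "(real^2) set" and x :: "real^2 \<Rightarrow> real^3"
  assumes open_U: "open U" and smooth: "smooth_on U x"
    and regular: "u \<in> U \<Longrightarrow> tangent_cross x u \<noteq> 0"
begin

abbreviation "n \<equiv> gauss_map x"
abbreviation "x\<^sub>1 \<equiv> partial_deriv 1 x"
abbreviation "x\<^sub>2 \<equiv> partial_deriv 2 x"
abbreviation "n\<^sub>1 \<equiv> partial_deriv 1 n"
abbreviation "n\<^sub>2 \<equiv> partial_deriv 2 n"

lemma differentiable_x: "u \<in> U \<Longrightarrow> x differentiable (at u)"
  and differentiable_xi: "u \<in> U \<Longrightarrow> partial_deriv i x differentiable (at u)"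
  and differentiable_xij: "u \<in> U \<Longrightarrow> partial_deriv j (partial_deriv i x) differentiable (at u)"
  using smooth_onD[OF _ open_U] smooth by blast+

lemma mixed_partials: "u \<in> U \<Longrightarrow> partial_deriv i (partial_deriv j x) u = partial_deriv j (partial_deriv i x) u"
  by (rule partial_deriv_commute[OF open_U]) (auto intro: differentiable_x differentiable_xi)

lemma differentiable_tangent_cross:
  assumes "u \<in> U"
  shows "tangent_cross x differentiable (at u)"
  unfolding tangent_cross_def[abs_def] using assms by (intro differentiable_cross3 differentiable_xi)

lemma differentiable_partial_tangent_cross:
  assumes "u \<in> U"
  shows "partial_deriv i (tangent_cross x) differentiable (at u)"
proof (rule differentiable_cong_open[OF open_U assms])
  fix v assume "v \<in> U"
  show "partial_deriv i (tangent_cross x) v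
      = cross3 (x\<^sub>1 v) (partial_deriv i x\<^sub>2 v) + cross3 (partial_deriv i x\<^sub>1 v) (x\<^sub>2 v)"
    unfolding tangent_cross_def[abs_def]
    by (rule partial_deriv_cross3) (auto intro: differentiable_xi \<open>v \<in> U\<close>)
qed (use assms in \<open>intro differentiable_add differentiable_cross3 differentiable_xi differentiable_xij\<close>)

lemma differentiable_n:
  assumes "u \<in> U"
  shows "n differentiable (at u)"
  unfolding gauss_map_def[abs_def]
  using differentiable_bilinear[OF bounded_bilinear_scaleR differentiable_inverse_norm]
    differentiable_tangent_cross regular assms by blast

text \<open>On \<open>U\<close> the derivatives of \<open>n\<close> agree with an explicit
  expression in \<open>tangent_cross x\<close>, its derivatives and its inverse norm, which can be
  differentiated once more.\<close>

lemma differentiable_ni: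
  assumes "u \<in> U"
  shows "partial_deriv i n differentiable (at u)"
proof (rule differentiable_cong_open[OF open_U assms])
  let ?m = "tangent_cross x"
  let ?s = "\<lambda>v. inverse (norm (?m v))"
  note dm = differentiable_tangent_cross
  have ds: "?s differentiable (at v)" if "v \<in> U" for v
    by (rule differentiable_inverse_norm[OF dm[OF that] regular[OF that]])
  show "partial_deriv i n v = ?s v *\<^sub>R partial_deriv i ?m v
      + (- (?s v^3) * (?m v \<bullet> partial_deriv i ?m v)) *\<^sub>R ?m v" if "v \<in> U" for v
    unfolding gauss_map_def[abs_def]
    by (simp only: partial_deriv_scaleR[OF ds[OF that] dm[OF that]]
        partial_deriv_inverse_norm[OF open_U that dm[OF that] regular])
  show "(\<lambda>v. ?s v *\<^sub>R partial_deriv i ?m v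
      + (- (?s v^3) * (?m v \<bullet> partial_deriv i ?m v)) *\<^sub>R ?m v) differentiable (at u)"
    using ds[OF assms] dm[OF assms] differentiable_partial_tangent_cross[OF assms, of i]
    by (intro differentiable_add differentiable_scaleR differentiable_mult differentiable_inner
        differentiable_minus differentiable_power)
qed

lemma norm_n: "u \<in> U \<Longrightarrow> n u \<bullet> n u = 1"
  using regular by (simp add: gauss_map_def dot_square_norm power2_eq_square)

lemma tangent_cross_eq: "u \<in> U \<Longrightarrow> cross3 (x\<^sub>1 u) (x\<^sub>2 u) = norm (tangent_cross x u) *\<^sub>R n u"
  using regular by (simp add: gauss_map_def tangent_cross_def)

lemma n_xi: "n u \<bullet> partial_deriv i x u = 0"
  using exhaust_2[of i] by (auto simp: gauss_map_def tangent_cross_def dot_cross_self inner_commute)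

text \<open>Yields that \<open>dn\<close> is tangential and the Weingarten relation, which trades
  second derivatives of \<open>x\<close> for first derivatives of \<open>n\<close>.\<close>

lemma partial_deriv_inner_zero:
  assumes "u \<in> U" "f differentiable (at u)" "g differentiable (at u)" "\<And>v. v \<in> U \<Longrightarrow> f v \<bullet> g v = c"
  shows "f u \<bullet> partial_deriv i g u + partial_deriv i f u \<bullet> g u = 0"
proof -
  have "partial_deriv i (\<lambda>v. f v \<bullet> g v) u = partial_deriv i (\<lambda>_. c) u"
    by (rule partial_deriv_cong[OF open_U]) (use assms in auto)
  then show ?thesis
    using partial_deriv_inner[OF assms(2,3)] by simp
qed

lemma n_ni: "u \<in> U \<Longrightarrow> n u \<bullet> partial_deriv i n u = 0"
  using partial_deriv_inner_zero[of u n n 1 i] differentiable_n norm_n by (simp add: inner_commute)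

lemma xij_n: "u \<in> U \<Longrightarrow> n u \<bullet> partial_deriv i (partial_deriv j x) u = - (partial_deriv i n u \<bullet> partial_deriv j x u)"
  using partial_deriv_inner_zero[of u n "partial_deriv j x" 0 i] differentiable_n differentiable_xi n_xi
  by simp

text \<open>The double cross product expansion gives \<open>y \<times> m = 0\<close> for the normal
  \<open>m\<close>; a further cross product with \<open>m\<close> exhibits \<open>y\<close> as a
  multiple of \<open>m\<close>.\<close>

lemma parallel_n:
  assumes "u \<in> U" "y \<bullet> x\<^sub>1 u = 0" "y \<bullet> x\<^sub>2 u = 0"
  shows "y = (y \<bullet> n u) *\<^sub>R n u"
proof -
  let ?m = "cross3 (x\<^sub>1 u) (x\<^sub>2 u)"
  have m: "?m \<noteq> 0" using regular[OF assms(1)] by (simp add: tangent_cross_def)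
  have "cross3 y ?m = 0" by (simp add: Lagrange assms)
  then have "cross3 ?m (cross3 y ?m) = 0" by simp
  then have "(?m \<bullet> ?m) *\<^sub>R y = (?m \<bullet> y) *\<^sub>R ?m"
    unfolding Lagrange[of ?m y ?m] by simp
  also have "\<dots> = (?m \<bullet> ?m) *\<^sub>R ((y \<bullet> n u) *\<^sub>R n u)"
    using m by (simp add: gauss_map_def tangent_cross_def inner_commute dot_square_norm power2_eq_square; simp add: field_simps)
  finally show ?thesis using m by (metis inner_eq_zero_iff scaleR_cancel_left)
qed

text \<open>Both derivatives of \<open>n\<close> are tangential, so their cross product is normal.
  The coefficient is the Gauss curvature times the norm of \<open>tangent_cross x u\<close>.\<close>

lemma cross_n12: "u \<in> U \<Longrightarrow> cross3 (n\<^sub>1 u) (n\<^sub>2 u) = (n u \<bullet> cross3 (n\<^sub>1 u) (n\<^sub>2 u)) *\<^sub>R n u"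
proof -
  assume u: "u \<in> U"
  let ?y = "cross3 (n\<^sub>1 u) (n\<^sub>2 u)"
  have "cross3 (n u) ?y = 0" using n_ni[OF u] by (simp add: Lagrange)
  then have "cross3 (n u) (cross3 ?y (n u)) = 0" using cross_skew[of ?y "n u"] by simp
  then have "(n u \<bullet> n u) *\<^sub>R ?y = (n u \<bullet> ?y) *\<^sub>R n u" by (simp add: Lagrange)
  then show ?thesis using norm_n[OF u] by simp
qed

text \<open>Lagrange's identity; it turns the root of the determinant into the norm of a cross
  product.\<close>

lemma det_third_form: "det (third_form x u) = (norm (cross3 (n\<^sub>1 u) (n\<^sub>2 u)))\<^sup>2"
  unfolding norm_cross by (simp add: third_form_def det_2 dot_square_norm inner_commute power2_eq_square)

text \<open>By the Weingarten relation and the Binet-Cauchy identity, the determinant of the second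
  form is the inner product of \<open>n\<^sub>1 \<times> n\<^sub>2\<close> and
  \<open>x\<^sub>1 \<times> x\<^sub>2\<close>. So without parabolic points the Gauss map is an
  immersion.\<close>

lemma gauss_curvature_zero:
  assumes "u \<in> U" "cross3 (n\<^sub>1 u) (n\<^sub>2 u) = 0"
  shows "gauss_curvature x u = 0"
proof -
  have "det (second_form x u) = cross3 (n\<^sub>1 u) (n\<^sub>2 u) \<bullet> cross3 (x\<^sub>1 u) (x\<^sub>2 u)"
    unfolding dot_cross
    by (simp add: second_form_def det_2 inner_commute[of _ "n u"] xij_n[OF assms(1)])
  then show ?thesis by (simp add: gauss_curvature_def assms(2))
qed

end

subsection \<open>The Beltrami operator of the third fundamental form\<close>

lemma matrix_inv_2:
  fixes M :: "real^2^2"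
  assumes "det M \<noteq> 0"
  shows "matrix_inv M = (\<chi> i j. (if i = j then M $ (if i = 1 then 2 else 1) $ (if i = 1 then 2 else 1) else - M $ i $ j) / det M)"
    (is "_ = ?B")
proof -
  have 1: "M ** ?B = mat 1"
    using assms
    by (simp add: vec_eq_iff matrix_matrix_mult_def sum_2 forall_2 mat_def diff_divide_distrib[symmetric]
        add_divide_distrib[symmetric] det_2 algebra_simps)
  have "matrix_inv M ** M = mat 1"
    using assms invertible_det_nz[of M] unfolding matrix_inv_def invertible_def by (metis (mono_tags, lifting) someI_ex)
  then have "matrix_inv M ** (M ** ?B) = ?B" unfolding matrix_mul_assoc by simp
  then show ?thesis by (simp only: 1 matrix_mul_rid)
qed

lemma matrix_inv_2_nth:
  fixes M :: "real^2^2"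
  assumes "det M \<noteq> 0"
  shows "matrix_inv M $ 1 $ 1 = M $ 2 $ 2 / det M" "matrix_inv M $ 1 $ 2 = - M $ 1 $ 2 / det M"
    "matrix_inv M $ 2 $ 1 = - M $ 2 $ 1 / det M" "matrix_inv M $ 2 $ 2 = M $ 1 $ 1 / det M"
  by (simp_all add: matrix_inv_2[OF assms])

context surface_patch
begin

text \<open>The vector fields \<open>\<surd>e e\<^sup>i\<^sup>j \<partial>\<^sub>i x\<close>, whose divergence is the Beltrami operator.\<close>

definition "flux\<^sub>1 u = (1 / norm (cross3 (n\<^sub>1 u) (n\<^sub>2 u))) *\<^sub>R
  ((n\<^sub>2 u \<bullet> n\<^sub>2 u) *\<^sub>R x\<^sub>1 u - (n\<^sub>1 u \<bullet> n\<^sub>2 u) *\<^sub>R x\<^sub>2 u)"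
definition "flux\<^sub>2 u = (1 / norm (cross3 (n\<^sub>1 u) (n\<^sub>2 u))) *\<^sub>R
  ((n\<^sub>1 u \<bullet> n\<^sub>1 u) *\<^sub>R x\<^sub>2 u - (n\<^sub>1 u \<bullet> n\<^sub>2 u) *\<^sub>R x\<^sub>1 u)"

lemma differentiable_flux:
  assumes "u \<in> U" "cross3 (n\<^sub>1 u) (n\<^sub>2 u) \<noteq> 0"
  shows "flux\<^sub>1 differentiable (at u)" "flux\<^sub>2 differentiable (at u)"
  unfolding flux\<^sub>1_def[abs_def] flux\<^sub>2_def[abs_def] divide_inverse mult_1
  by (intro differentiable_scaleR differentiable_diff differentiable_inner differentiable_inverse_norm
      differentiable_cross3 differentiable_ni differentiable_xi assms)+

text \<open>The inverse of the third form is its cofactor matrix over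
  \<open>|n\<^sub>1 \<times> n\<^sub>2|\<^sup>2\<close>; the root of the determinant cancels one of
  the two factors, which leaves the fluxes.\<close>

lemma beltrami_III_vec_eq:
  assumes "u \<in> U" and nz: "\<And>v. v \<in> U \<Longrightarrow> cross3 (n\<^sub>1 v) (n\<^sub>2 v) \<noteq> 0"
  shows "beltrami_III_vec x x u = - (1 / norm (cross3 (n\<^sub>1 u) (n\<^sub>2 u))) *\<^sub>R
    (partial_deriv 1 flux\<^sub>1 u + partial_deriv 2 flux\<^sub>2 u)"
proof -
  have comp: "partial_deriv i (\<lambda>v. f v $ k) v = partial_deriv i f v $ k"
    if "f differentiable (at v)" for f :: "real^2 \<Rightarrow> real^3" and i v k
    by (rule partial_deriv_linear[OF bounded_linear_vec_nth that])
  have e: "sqrt (det (third_form x v)) = norm (cross3 (n\<^sub>1 v) (n\<^sub>2 v))" for v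
    by (simp add: det_third_form)
  have "partial_deriv j (\<lambda>v. \<Sum>i\<in>UNIV. sqrt (det (third_form x v)) * matrix_inv (third_form x v) $ i $ j
        * partial_deriv i (\<lambda>v. x v $ k) v) u = partial_deriv j (if j = 1 then flux\<^sub>1 else flux\<^sub>2) u $ k" for j k
  proof -
    have "partial_deriv j (\<lambda>v. \<Sum>i\<in>UNIV. sqrt (det (third_form x v)) * matrix_inv (third_form x v) $ i $ j
        * partial_deriv i (\<lambda>v. x v $ k) v) u = partial_deriv j (\<lambda>v. (if j = 1 then flux\<^sub>1 else flux\<^sub>2) v $ k) u"
    proof (rule partial_deriv_cong[OF open_U assms(1)])
      fix v assume v: "v \<in> U"
      then have d: "det (third_form x v) \<noteq> 0" using nz by (simp add: det_third_form)
      consider "j = 1" | "j = 2" using exhaust_2 by blast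
      then show "(\<Sum>i\<in>UNIV. sqrt (det (third_form x v)) * matrix_inv (third_form x v) $ i $ j
        * partial_deriv i (\<lambda>v. x v $ k) v) = (if j = 1 then flux\<^sub>1 else flux\<^sub>2) v $ k"
        using nz[OF v] unfolding e sum_2 comp[OF differentiable_x[OF v]]
        by cases (simp_all only: matrix_inv_2_nth[OF d] det_third_form, simp_all add: flux\<^sub>1_def flux\<^sub>2_def
            third_form_def inner_commute power2_eq_square field_simps)
    qed
    also have "\<dots> = partial_deriv j (if j = 1 then flux\<^sub>1 else flux\<^sub>2) u $ k"
      using differentiable_flux[OF assms(1) nz[OF assms(1)]] by (intro comp) auto
    finally show ?thesis .
  qed
  then show ?thesis
    by (simp add: beltrami_III_vec_def beltrami_III_def vec_eq_iff sum_2 e)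
qed

text \<open>On a sphere \<open>n\<close> is a constant multiple of \<open>x\<close>, so the fluxes become \<open>\<partial>\<^sub>2 x \<times> n\<close> and \<open>n \<times> \<partial>\<^sub>1 x\<close>.\<close>

lemma beltrami_sphere:
  assumes "u \<in> U" and "r > 0" and sph: "\<And>v. v \<in> U \<Longrightarrow> norm (x v) = r"
  shows "beltrami_III_vec x x u = 2 *\<^sub>R x u"
proof -
  define s where "s v = x v \<bullet> n v" for v
  have xn: "x v = s v *\<^sub>R n v" if "v \<in> U" for v
  proof -
    have "x v \<bullet> partial_deriv i x v = 0" for i
      using partial_deriv_inner_zero[OF that differentiable_x[OF that] differentiable_x[OF that], of "r^2" i] sph
      by (simp add: dot_square_norm inner_commute)
    then show ?thesis unfolding s_def using parallel_n[OF that] by blast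
  qed
  have s2: "s v * s v = r^2" if "v \<in> U" for v
  proof -
    have "x v \<bullet> x v = s v * s v"
      by (subst (1 2) xn[OF that]) (simp add: norm_n[OF that])
    then show ?thesis using sph[OF that] by (simp add: dot_square_norm)
  qed
  have s_nz: "s v \<noteq> 0" if "v \<in> U" for v using s2[OF that] \<open>r > 0\<close> by auto
  have ds: "s differentiable (at v)" if "v \<in> U" for v
    unfolding s_def[abs_def] using that by (intro differentiable_inner differentiable_x differentiable_n)
  \<comment> \<open>\<open>s\<close> is \<open>r\<close> or \<open>- r\<close>, possibly different
    on different components of \<open>U\<close>; differentiating
    \<open>s\<^sup>2 = r\<^sup>2\<close> and cancelling \<open>s\<close> covers both signs.\<close>
  have si: "partial_deriv i s v = 0" if "v \<in> U" for v i
    using partial_deriv_inner_zero[OF that ds[OF that] ds[OF that], of "r^2" i] s2 s_nz[OF that] by simp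
  have xi: "partial_deriv i x v = s v *\<^sub>R partial_deriv i n v" if "v \<in> U" for v i
  proof -
    have "partial_deriv i x v = partial_deriv i (\<lambda>v. s v *\<^sub>R n v) v"
      by (rule partial_deriv_cong[OF open_U that xn])
    then show ?thesis
      using partial_deriv_scaleR[OF ds[OF that] differentiable_n[OF that]] by (simp add: si[OF that])
  qed
  \<comment> \<open>\<open>1 / s\<close> is written as \<open>s / r\<^sup>2\<close>, so that a
    product of two such factors loses its sign.\<close>
  have ni: "partial_deriv i n v = (s v / r^2) *\<^sub>R partial_deriv i x v" if "v \<in> U" for v i
    using s2[OF that] \<open>r > 0\<close> by (simp add: xi[OF that])
  have s4: "(s v * s v) / (r^2 * r^2) = 1 / r^2" if "v \<in> U" for v
    unfolding s2[OF that] using \<open>r > 0\<close> by (simp add: field_simps)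
  have n12: "cross3 (n\<^sub>1 v) (n\<^sub>2 v) = (norm (tangent_cross x v) / r^2) *\<^sub>R n v" if "v \<in> U" for v
  proof -
    have "cross3 (n\<^sub>1 v) (n\<^sub>2 v) = ((s v * s v) / (r^2 * r^2)) *\<^sub>R cross3 (x\<^sub>1 v) (x\<^sub>2 v)"
      by (simp add: ni[OF that] cross_mult_left cross_mult_right)
    then show ?thesis by (simp only: tangent_cross_eq[OF that] s4[OF that]) simp
  qed
  have m: "norm (tangent_cross x v) > 0" if "v \<in> U" for v using regular[OF that] by simp
  have norm_n12: "norm (cross3 (n\<^sub>1 v) (n\<^sub>2 v)) = norm (tangent_cross x v) / r^2" if "v \<in> U" for v
    using norm_n[OF that] by (simp add: n12[OF that] norm_eq_1)
  have nz: "cross3 (n\<^sub>1 v) (n\<^sub>2 v) \<noteq> 0" if "v \<in> U" for v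
    using norm_n12[OF that] m[OF that] \<open>r > 0\<close> by auto
  \<comment> \<open>Expansion of a double cross product, \<open>n\<close> being the normalised
    \<open>x\<^sub>1 \<times> x\<^sub>2\<close>. The result is the flux formula with the
    \<open>x\<^sub>i\<close> in place of the \<open>n\<^sub>i\<close> in the coefficients.\<close>
  have L1: "cross3 (x\<^sub>2 v) (n v) = (1 / norm (tangent_cross x v)) *\<^sub>R ((x\<^sub>2 v \<bullet> x\<^sub>2 v) *\<^sub>R x\<^sub>1 v - (x\<^sub>1 v \<bullet> x\<^sub>2 v) *\<^sub>R x\<^sub>2 v)" for v
    by (simp add: gauss_map_def tangent_cross_def cross_mult_right Lagrange inner_commute divide_inverse)
  have L2: "cross3 (n v) (x\<^sub>1 v) = (1 / norm (tangent_cross x v)) *\<^sub>R ((x\<^sub>1 v \<bullet> x\<^sub>1 v) *\<^sub>R x\<^sub>2 v - (x\<^sub>1 v \<bullet> x\<^sub>2 v) *\<^sub>R x\<^sub>1 v)" for v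
    using cross_skew[of "n v" "x\<^sub>1 v"]
    by (simp add: gauss_map_def tangent_cross_def cross_mult_right Lagrange inner_commute divide_inverse
        scaleR_diff_right[symmetric] scaleR_minus_right[symmetric] del: scaleR_minus_right)
  have nn: "partial_deriv i n v \<bullet> partial_deriv j n v = (1 / r^2) * (partial_deriv i x v \<bullet> partial_deriv j x v)" if "v \<in> U" for i j v
  proof -
    have "partial_deriv i n v \<bullet> partial_deriv j n v = (s v * s v) / (r^2 * r^2) * (partial_deriv i x v \<bullet> partial_deriv j x v)"
      by (simp add: ni[OF that])
    then show ?thesis by (simp only: s4[OF that])
  qed
  have f1: "flux\<^sub>1 v = cross3 (x\<^sub>2 v) (n v)" if "v \<in> U" for v
    unfolding flux\<^sub>1_def L1 norm_n12[OF that] nn[OF that] using \<open>r > 0\<close>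
    by (simp add: scaleR_diff_right)
  have f2: "flux\<^sub>2 v = cross3 (n v) (x\<^sub>1 v)" if "v \<in> U" for v
    unfolding flux\<^sub>2_def L2 norm_n12[OF that] nn[OF that] using \<open>r > 0\<close>
    by (simp add: scaleR_diff_right)
  note u = assms(1)
  have "partial_deriv 1 flux\<^sub>1 u = partial_deriv 1 (\<lambda>v. cross3 (x\<^sub>2 v) (n v)) u"
    by (rule partial_deriv_cong[OF open_U u f1])
  also have "\<dots> = cross3 (x\<^sub>2 u) (n\<^sub>1 u) + cross3 (partial_deriv 1 x\<^sub>2 u) (n u)"
    by (rule partial_deriv_cross3) (auto intro: differentiable_xi differentiable_n u)
  finally have p1: "partial_deriv 1 flux\<^sub>1 u = cross3 (x\<^sub>2 u) (n\<^sub>1 u) + cross3 (partial_deriv 1 x\<^sub>2 u) (n u)" .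
  have "partial_deriv 2 flux\<^sub>2 u = partial_deriv 2 (\<lambda>v. cross3 (n v) (x\<^sub>1 v)) u"
    by (rule partial_deriv_cong[OF open_U u f2])
  also have "\<dots> = cross3 (n u) (partial_deriv 2 x\<^sub>1 u) + cross3 (n\<^sub>2 u) (x\<^sub>1 u)"
    by (rule partial_deriv_cross3) (auto intro: differentiable_xi differentiable_n u)
  \<comment> \<open>The mixed second derivatives of \<open>x\<close> are equal and enter with
    opposite signs, so only first derivatives survive.\<close>
  finally have "partial_deriv 1 flux\<^sub>1 u + partial_deriv 2 flux\<^sub>2 u = cross3 (x\<^sub>2 u) (n\<^sub>1 u) + cross3 (n\<^sub>2 u) (x\<^sub>1 u)"
    using cross_skew[of "n u" "partial_deriv 2 x\<^sub>1 u"] by (simp add: p1 mixed_partials[OF u, of 1 2])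
  also have "\<dots> = (2 * s u) *\<^sub>R cross3 (n\<^sub>2 u) (n\<^sub>1 u)"
    by (simp add: xi[OF u] cross_mult_left cross_mult_right scaleR_left_distrib[symmetric])
  also have "cross3 (n\<^sub>2 u) (n\<^sub>1 u) = - cross3 (n\<^sub>1 u) (n\<^sub>2 u)" by (rule cross_skew)
  also have "\<dots> = - ((norm (tangent_cross x u) / r^2) *\<^sub>R n u)" by (simp add: n12[OF u])
  finally show ?thesis
    using \<open>r > 0\<close> m[OF u] xn[OF u]
    by (simp add: beltrami_III_vec_eq[OF u nz] norm_n12[OF u])
qed

text \<open>\<open>flux\<^sub>j \<bullet> n = 0\<close>, so the normal component of the divergence involves no second derivatives of \<open>x\<close>.\<close>

lemma beltrami_normal:
  assumes u: "u \<in> U" and nz: "\<And>v. v \<in> U \<Longrightarrow> cross3 (n\<^sub>1 v) (n\<^sub>2 v) \<noteq> 0"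
  shows "(beltrami_III_vec x x u \<bullet> n u) * (n u \<bullet> cross3 (n\<^sub>1 u) (n\<^sub>2 u))
    = n u \<bullet> (cross3 (x\<^sub>1 u) (n\<^sub>2 u) + cross3 (n\<^sub>1 u) (x\<^sub>2 u))"
proof -
  define y where "y = cross3 (n\<^sub>1 u) (n\<^sub>2 u)"
  define \<delta> where "\<delta> = n u \<bullet> y"
  have y: "y = \<delta> *\<^sub>R n u" unfolding \<delta>_def y_def by (rule cross_n12[OF u])
  have y0: "y \<noteq> 0" using nz[OF u] by (simp add: y_def)
  then have \<delta>0: "\<delta> \<noteq> 0" using y by auto
  \<comment> \<open>\<open>norm y\<close> is only the absolute value of \<open>\<delta>\<close>, but
    it enters the final formula squared.\<close>
  have ny: "norm y * norm y = \<delta> * \<delta>"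
    using norm_n[OF u] by (subst (1 2) y) (simp add: norm_eq_1[symmetric])
  have "partial_deriv i f u \<bullet> n u = - (f u \<bullet> partial_deriv i n u)"
    if "f differentiable (at u)" "\<And>v. f v \<bullet> n v = 0" for f i
    using partial_deriv_inner_zero[OF u that(1) differentiable_n[OF u], of 0 i] that(2) by simp
  moreover have "flux\<^sub>1 v \<bullet> n v = 0" "flux\<^sub>2 v \<bullet> n v = 0" for v
    using n_xi[of v] by (simp_all add: flux\<^sub>1_def flux\<^sub>2_def inner_diff_left inner_diff_right inner_commute[of _ "n v"])
  ultimately have "(partial_deriv 1 flux\<^sub>1 u + partial_deriv 2 flux\<^sub>2 u) \<bullet> n u = - (flux\<^sub>1 u \<bullet> n\<^sub>1 u + flux\<^sub>2 u \<bullet> n\<^sub>2 u)"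
    using differentiable_flux[OF u nz[OF u]] by (simp add: inner_add_left)
  \<comment> \<open>Binet-Cauchy read backwards: the four products of inner products are those of
    \<open>y\<close> with the two mixed cross products.\<close>
  also have "flux\<^sub>1 u \<bullet> n\<^sub>1 u + flux\<^sub>2 u \<bullet> n\<^sub>2 u
    = (1 / norm y) * (y \<bullet> (cross3 (x\<^sub>1 u) (n\<^sub>2 u) + cross3 (n\<^sub>1 u) (x\<^sub>2 u)))"
    unfolding y_def flux\<^sub>1_def flux\<^sub>2_def
    by (simp add: inner_add_right inner_add_left inner_diff_left dot_cross inner_commute algebra_simps)
  finally have "beltrami_III_vec x x u \<bullet> n u
    = 1 / (norm y * norm y) * (y \<bullet> (cross3 (x\<^sub>1 u) (n\<^sub>2 u) + cross3 (n\<^sub>1 u) (x\<^sub>2 u)))"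
    by (simp add: beltrami_III_vec_eq[OF u nz] y_def)
  also have "\<dots> = 1 / \<delta> * (n u \<bullet> (cross3 (x\<^sub>1 u) (n\<^sub>2 u) + cross3 (n\<^sub>1 u) (x\<^sub>2 u)))"
    using \<delta>0 by (simp only: ny) (simp add: y)
  finally show ?thesis using \<delta>0 by (simp add: \<delta>_def y_def)
qed

end

subsection \<open>Patches on a quadric\<close>

lemma matrix_vector_inner:
  fixes A :: "real^'n^'n"
  shows "(A *v p) \<bullet> q = p \<bullet> (transpose A *v q)"
  by (metis dot_lmul_matrix inner_commute transpose_matrix_vector transpose_transpose)

text \<open>Taking the third vector as a cross product makes the frame right-handed: cross products
  have the usual coordinates, and cyclic shifts preserve all assumptions.\<close>

locale eigenframe =
  fixes A :: "real^3^3" and e\<^sub>1 e\<^sub>2 e\<^sub>3 :: "real^3" and a\<^sub>1 a\<^sub>2 a\<^sub>3 :: real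
  assumes unit: "e\<^sub>1 \<bullet> e\<^sub>1 = 1" "e\<^sub>2 \<bullet> e\<^sub>2 = 1" and orth: "e\<^sub>1 \<bullet> e\<^sub>2 = 0" and e\<^sub>3: "e\<^sub>3 = cross3 e\<^sub>1 e\<^sub>2"
    and eig: "A *v e\<^sub>1 = a\<^sub>1 *\<^sub>R e\<^sub>1" "A *v e\<^sub>2 = a\<^sub>2 *\<^sub>R e\<^sub>2" "A *v e\<^sub>3 = a\<^sub>3 *\<^sub>R e\<^sub>3"
begin

lemma frame [simp]:
  "e\<^sub>1 \<bullet> e\<^sub>1 = 1" "e\<^sub>2 \<bullet> e\<^sub>2 = 1" "e\<^sub>3 \<bullet> e\<^sub>3 = 1" "e\<^sub>1 \<bullet> e\<^sub>2 = 0" "e\<^sub>2 \<bullet> e\<^sub>1 = 0"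
  "e\<^sub>1 \<bullet> e\<^sub>3 = 0" "e\<^sub>3 \<bullet> e\<^sub>1 = 0" "e\<^sub>2 \<bullet> e\<^sub>3 = 0" "e\<^sub>3 \<bullet> e\<^sub>2 = 0"
  using unit orth by (simp_all add: e\<^sub>3 dot_cross_self dot_cross inner_commute)

lemma cross_frame: "cross3 e\<^sub>2 e\<^sub>3 = e\<^sub>1" "cross3 e\<^sub>3 e\<^sub>1 = e\<^sub>2" "cross3 e\<^sub>1 e\<^sub>2 = e\<^sub>3"
  using cross_skew[of e\<^sub>3 e\<^sub>1] by (simp_all add: e\<^sub>3 Lagrange orth unit inner_commute)

text \<open>Lets an argument about one eigenvalue, or one pair of them, cover all three.\<close>

lemma cycle: "eigenframe A e\<^sub>2 e\<^sub>3 e\<^sub>1 a\<^sub>2 a\<^sub>3 a\<^sub>1"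
  by unfold_locales (simp_all add: cross_frame eig)

lemma frame_zero:
  assumes "y \<bullet> e\<^sub>1 = 0" "y \<bullet> e\<^sub>2 = 0" "y \<bullet> e\<^sub>3 = 0"
  shows "y = 0"
proof -
  have "cross3 y e\<^sub>3 = 0" using assms by (simp add: e\<^sub>3 Lagrange)
  moreover have "e\<^sub>3 \<noteq> 0" using frame(3) by (metis inner_zero_left zero_neq_one)
  ultimately show ?thesis using assms(3) norm_and_cross_eq_0 by blast
qed

lemma frame_expand: "v = (v \<bullet> e\<^sub>1) *\<^sub>R e\<^sub>1 + (v \<bullet> e\<^sub>2) *\<^sub>R e\<^sub>2 + (v \<bullet> e\<^sub>3) *\<^sub>R e\<^sub>3"
proof -
  have "v - ((v \<bullet> e\<^sub>1) *\<^sub>R e\<^sub>1 + (v \<bullet> e\<^sub>2) *\<^sub>R e\<^sub>2 + (v \<bullet> e\<^sub>3) *\<^sub>R e\<^sub>3) = 0"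
    by (rule frame_zero) (simp_all add: inner_diff_left inner_add_left)
  then show ?thesis by simp
qed

lemma frame_inner: "v \<bullet> w = (v \<bullet> e\<^sub>1) * (w \<bullet> e\<^sub>1) + (v \<bullet> e\<^sub>2) * (w \<bullet> e\<^sub>2) + (v \<bullet> e\<^sub>3) * (w \<bullet> e\<^sub>3)"
  by (subst frame_expand[of v]) (simp add: inner_add_left inner_add_right inner_commute)

lemma A_expand: "A *v v = (a\<^sub>1 * (v \<bullet> e\<^sub>1)) *\<^sub>R e\<^sub>1 + (a\<^sub>2 * (v \<bullet> e\<^sub>2)) *\<^sub>R e\<^sub>2 + (a\<^sub>3 * (v \<bullet> e\<^sub>3)) *\<^sub>R e\<^sub>3"
  by (subst frame_expand[of v])
    (simp add: matrix_vector_right_distrib matrix_vector_mult_scaleR eig mult.commute)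

lemma A_inner: "(A *v v) \<bullet> e\<^sub>1 = a\<^sub>1 * (v \<bullet> e\<^sub>1)" "(A *v v) \<bullet> e\<^sub>2 = a\<^sub>2 * (v \<bullet> e\<^sub>2)" "(A *v v) \<bullet> e\<^sub>3 = a\<^sub>3 * (v \<bullet> e\<^sub>3)"
  by (simp_all add: A_expand inner_add_left)

lemma cross_inner:
  "cross3 v w \<bullet> e\<^sub>1 = (v \<bullet> e\<^sub>2) * (w \<bullet> e\<^sub>3) - (v \<bullet> e\<^sub>3) * (w \<bullet> e\<^sub>2)"
  "cross3 v w \<bullet> e\<^sub>2 = (v \<bullet> e\<^sub>3) * (w \<bullet> e\<^sub>1) - (v \<bullet> e\<^sub>1) * (w \<bullet> e\<^sub>3)"
  "cross3 v w \<bullet> e\<^sub>3 = (v \<bullet> e\<^sub>1) * (w \<bullet> e\<^sub>2) - (v \<bullet> e\<^sub>2) * (w \<bullet> e\<^sub>1)"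
  using dot_cross[of v w e\<^sub>2 e\<^sub>3] dot_cross[of v w e\<^sub>3 e\<^sub>1] dot_cross[of v w e\<^sub>1 e\<^sub>2]
  unfolding cross_frame by simp_all

text \<open>The quadratic forms of \<open>adj A\<close> and \<open>tr A - A\<close>.\<close>

definition "cofactor_form v = a\<^sub>2 * a\<^sub>3 * (v \<bullet> e\<^sub>1)\<^sup>2 + a\<^sub>3 * a\<^sub>1 * (v \<bullet> e\<^sub>2)\<^sup>2 + a\<^sub>1 * a\<^sub>2 * (v \<bullet> e\<^sub>3)\<^sup>2"
definition "cotrace_form v = (a\<^sub>2 + a\<^sub>3) * (v \<bullet> e\<^sub>1)\<^sup>2 + (a\<^sub>3 + a\<^sub>1) * (v \<bullet> e\<^sub>2)\<^sup>2 + (a\<^sub>1 + a\<^sub>2) * (v \<bullet> e\<^sub>3)\<^sup>2"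

text \<open>For symmetric \<open>A\<close>,
  \<open>A v \<times> A w = adj A (v \<times> w)\<close>.\<close>

lemma cofactor_form_cross:
  assumes "cross3 v w = l *\<^sub>R m"
  shows "m \<bullet> cross3 (A *v v) (A *v w) = l * cofactor_form m"
proof -
  have "(v \<bullet> e\<^sub>2) * (w \<bullet> e\<^sub>3) - (v \<bullet> e\<^sub>3) * (w \<bullet> e\<^sub>2) = l * (m \<bullet> e\<^sub>1)"
    "(v \<bullet> e\<^sub>3) * (w \<bullet> e\<^sub>1) - (v \<bullet> e\<^sub>1) * (w \<bullet> e\<^sub>3) = l * (m \<bullet> e\<^sub>2)"
    "(v \<bullet> e\<^sub>1) * (w \<bullet> e\<^sub>2) - (v \<bullet> e\<^sub>2) * (w \<bullet> e\<^sub>1) = l * (m \<bullet> e\<^sub>3)"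
    using cross_inner[of v w] unfolding assms by simp_all
  note X = this
  have "m \<bullet> cross3 (A *v v) (A *v w) =
      a\<^sub>2 * a\<^sub>3 * (m \<bullet> e\<^sub>1) * ((v \<bullet> e\<^sub>2) * (w \<bullet> e\<^sub>3) - (v \<bullet> e\<^sub>3) * (w \<bullet> e\<^sub>2))
    + a\<^sub>3 * a\<^sub>1 * (m \<bullet> e\<^sub>2) * ((v \<bullet> e\<^sub>3) * (w \<bullet> e\<^sub>1) - (v \<bullet> e\<^sub>1) * (w \<bullet> e\<^sub>3))
    + a\<^sub>1 * a\<^sub>2 * (m \<bullet> e\<^sub>3) * ((v \<bullet> e\<^sub>1) * (w \<bullet> e\<^sub>2) - (v \<bullet> e\<^sub>2) * (w \<bullet> e\<^sub>1))"
    by (subst frame_inner) (simp add: cross_inner A_inner algebra_simps)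
  then show ?thesis
    unfolding X cofactor_form_def by (simp add: power2_eq_square algebra_simps)
qed

text \<open>The first-order term in \<open>t\<close> of the adjugate identity for
  \<open>I + t A\<close>:
  \<open>v \<times> A w + A v \<times> w = (tr A - A) (v \<times> w)\<close>.\<close>

lemma cotrace_form_cross:
  assumes "cross3 v w = l *\<^sub>R m"
  shows "m \<bullet> (cross3 v (A *v w) + cross3 (A *v v) w) = l * cotrace_form m"
proof -
  have "(v \<bullet> e\<^sub>2) * (w \<bullet> e\<^sub>3) - (v \<bullet> e\<^sub>3) * (w \<bullet> e\<^sub>2) = l * (m \<bullet> e\<^sub>1)"
    "(v \<bullet> e\<^sub>3) * (w \<bullet> e\<^sub>1) - (v \<bullet> e\<^sub>1) * (w \<bullet> e\<^sub>3) = l * (m \<bullet> e\<^sub>2)"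
    "(v \<bullet> e\<^sub>1) * (w \<bullet> e\<^sub>2) - (v \<bullet> e\<^sub>2) * (w \<bullet> e\<^sub>1) = l * (m \<bullet> e\<^sub>3)"
    using cross_inner[of v w] unfolding assms by simp_all
  note X = this
  have "m \<bullet> (cross3 v (A *v w) + cross3 (A *v v) w) =
      (a\<^sub>2 + a\<^sub>3) * (m \<bullet> e\<^sub>1) * ((v \<bullet> e\<^sub>2) * (w \<bullet> e\<^sub>3) - (v \<bullet> e\<^sub>3) * (w \<bullet> e\<^sub>2))
    + (a\<^sub>3 + a\<^sub>1) * (m \<bullet> e\<^sub>2) * ((v \<bullet> e\<^sub>3) * (w \<bullet> e\<^sub>1) - (v \<bullet> e\<^sub>1) * (w \<bullet> e\<^sub>3))
    + (a\<^sub>1 + a\<^sub>2) * (m \<bullet> e\<^sub>3) * ((v \<bullet> e\<^sub>1) * (w \<bullet> e\<^sub>2) - (v \<bullet> e\<^sub>2) * (w \<bullet> e\<^sub>1))"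
    by (subst frame_inner) (simp add: inner_add_left cross_inner A_inner algebra_simps)
  then show ?thesis
    unfolding X cotrace_form_def by (simp add: power2_eq_square algebra_simps)
qed

end

text \<open>The unit vector maximises the Rayleigh quotient of \<open>A\<close> on \<open>V\<close>.\<close>

lemma rayleigh_maximiser:
  fixes A :: "real^'n^'n"
  assumes A: "transpose A = A" and V: "subspace V" "closed V" "v \<in> V" "v \<noteq> 0"
  obtains e where "e \<in> V" "e \<bullet> e = 1" "\<And>w. w \<in> V \<Longrightarrow> w \<bullet> e = 0 \<Longrightarrow> (A *v e) \<bullet> w = 0"
proof -
  have "v /\<^sub>R norm v \<in> sphere 0 1 \<inter> V" using V by (simp add: subspace_scale)
  moreover have "compact (sphere 0 1 \<inter> V)" using V(2) by (simp add: compact_Int_closed)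
  moreover have "continuous_on (sphere 0 1 \<inter> V) (\<lambda>x. x \<bullet> (A *v x))"
    by (intro continuous_intros linear_continuous_on matrix_vector_mul_bounded_linear)
  ultimately obtain e where e: "e \<in> sphere 0 1 \<inter> V" "\<And>y. y \<in> sphere 0 1 \<inter> V \<Longrightarrow> y \<bullet> (A *v y) \<le> e \<bullet> (A *v e)"
    using continuous_attains_sup[of "sphere 0 1 \<inter> V" "\<lambda>x. x \<bullet> (A *v x)"] by blast
  have e1: "e \<bullet> e = 1" using e(1) by (simp add: norm_eq_1)
  define a where "a = e \<bullet> (A *v e)"
  have le: "y \<bullet> (A *v y) \<le> a * (y \<bullet> y)" if "y \<in> V" for y
  proof (cases "y = 0")
    case False
    then have "(y /\<^sub>R norm y) \<bullet> (A *v (y /\<^sub>R norm y)) \<le> a"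
      unfolding a_def using that V by (intro e(2)) (simp add: subspace_scale)
    then have "(y \<bullet> (A *v y)) / (norm y * norm y) \<le> a"
      by (simp add: matrix_vector_mult_scaleR field_simps)
    then show ?thesis using False by (simp add: dot_square_norm power2_eq_square field_simps)
  qed simp
  have "(A *v e) \<bullet> w = 0" if w: "w \<in> V" "w \<bullet> e = 0" for w
  proof (rule ccontr)
    define \<alpha> where "\<alpha> = (A *v e) \<bullet> w"
    define \<beta> where "\<beta> = a * (w \<bullet> w) - w \<bullet> (A *v w)"
    assume "(A *v e) \<bullet> w \<noteq> 0"
    then have \<alpha>: "\<alpha> \<noteq> 0" by (simp add: \<alpha>_def)
    have sym: "e \<bullet> (A *v w) = \<alpha>" using matrix_vector_inner[of A e w] A by (simp add: \<alpha>_def)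
    have t: "2 * t * \<alpha> \<le> t * t * \<beta>" for t
    proof -
      have "e + t *\<^sub>R w \<in> V" using e(1) w V by (simp add: subspace_add subspace_scale)
      from le[OF this] show ?thesis
        using sym e1 w(2)
        by (simp add: matrix_vector_right_distrib matrix_vector_mult_scaleR inner_add_left inner_add_right
            a_def[symmetric] \<beta>_def \<alpha>_def inner_commute algebra_simps)
    qed
    \<comment> \<open>In \<open>2 t \<alpha> \<le> t\<^sup>2 \<beta>\<close> the choice
      \<open>t = \<alpha> / s\<close> with \<open>s\<close> above the absolute value of
      \<open>\<beta>\<close> makes the linear term win.\<close>
    define s where "s = \<bar>\<beta>\<bar> + 1"
    have s: "s > 0" by (simp add: s_def)
    have "2 * (\<alpha> / s) * \<alpha> * (s * s) \<le> (\<alpha> / s) * (\<alpha> / s) * \<beta> * (s * s)"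
      by (rule mult_right_mono[OF t]) simp
    then have "2 * (\<alpha> * \<alpha>) * s \<le> (\<alpha> * \<alpha>) * \<beta>"
      using s by (simp add: field_simps)
    then have "(\<alpha> * \<alpha>) * (2 * s - \<beta>) \<le> 0" by (simp add: algebra_simps)
    moreover have "\<alpha> * \<alpha> > 0" using \<alpha> not_real_square_gt_zero by blast
    moreover have "2 * s - \<beta> > 0" by (simp add: s_def)
    ultimately show False using mult_pos_pos not_le by blast
  qed
  then show thesis using that[of e] e(1) e1 by blast
qed

text \<open>Maximise over the whole space, then over the plane orthogonal to \<open>e1\<close>. The
  orthogonality conditions of both maximisers and the symmetry of \<open>A\<close> kill every
  off-diagonal entry.\<close>

lemma eigenframe_exists:
  fixes A :: "real^3^3"
  assumes A: "transpose A = A"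
  obtains e1 e2 e3 a1 a2 a3 where "eigenframe A e1 e2 e3 a1 a2 a3"
proof -
  have sym: "(A *v p) \<bullet> q = p \<bullet> (A *v q)" for p q
    using matrix_vector_inner[of A p q] A by simp
  obtain e1 where e1: "e1 \<bullet> e1 = 1" "\<And>w. w \<bullet> e1 = 0 \<Longrightarrow> (A *v e1) \<bullet> w = 0"
    using rayleigh_maximiser[OF A subspace_UNIV closed_UNIV, of "axis 1 1"] by (auto simp: axis_eq_0_iff)
  obtain z where z: "cross3 e1 z \<noteq> 0"
    using cross_basis_nonzero[of e1] e1(1) by (metis inner_zero_left zero_neq_one)
  have V: "subspace {w. w \<bullet> e1 = 0}" "closed {w. w \<bullet> e1 = 0}" "cross3 e1 z \<in> {w. w \<bullet> e1 = 0}"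
    using subspace_hyperplane[of e1] closed_hyperplane[of e1 0] by (simp_all add: inner_commute dot_cross_self)
  obtain e2 where e2: "e1 \<bullet> e2 = 0" "e2 \<bullet> e2 = 1" "\<And>w. w \<bullet> e1 = 0 \<Longrightarrow> w \<bullet> e2 = 0 \<Longrightarrow> (A *v e2) \<bullet> w = 0"
    using rayleigh_maximiser[OF A V z] by (auto simp: inner_commute)
  define e3 where "e3 = cross3 e1 e2"
  \<comment> \<open>The zero matrix stands in for \<open>A\<close>: it gives access to the frame
    expansion, from which the eigenvector equations of \<open>A\<close> are then derived.\<close>
  interpret F: eigenframe 0 e1 e2 e3 0 0 0
    by unfold_locales (simp_all add: e1 e2 e3_def)
  have off: "(A *v e1) \<bullet> e2 = 0" "(A *v e1) \<bullet> e3 = 0" "(A *v e2) \<bullet> e3 = 0"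
    by (simp_all add: e1(2) e2(3))
  have off': "(A *v e2) \<bullet> e1 = 0" "(A *v e3) \<bullet> e1 = 0" "(A *v e3) \<bullet> e2 = 0"
    using off sym[of e2 e1] sym[of e3 e1] sym[of e3 e2] by (simp_all add: inner_commute)
  have E: "A *v e1 = ((A *v e1) \<bullet> e1) *\<^sub>R e1" "A *v e2 = ((A *v e2) \<bullet> e2) *\<^sub>R e2" "A *v e3 = ((A *v e3) \<bullet> e3) *\<^sub>R e3"
    using F.frame_expand[of "A *v e1"] F.frame_expand[of "A *v e2"] F.frame_expand[of "A *v e3"]
    by (simp_all add: off off')
  have "eigenframe A e1 e2 e3 ((A *v e1) \<bullet> e1) ((A *v e2) \<bullet> e2) ((A *v e3) \<bullet> e3)"
    by unfold_locales (rule e1 e2 e3_def E)+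
  then show thesis by (rule that)
qed

section \<open>The half-gradient along a patch\<close>

context surface_patch
begin

text \<open>Such an \<open>F\<close> is a multiple of \<open>n\<close>, and differentiating the
  multiplier only adds multiples of \<open>n\<close>, which the triple products with
  \<open>n\<close> annihilate. Hence the unnormalised gradient can replace \<open>n\<close>.\<close>

lemma normal_field:
  assumes u: "u \<in> U" and F: "\<And>v. v \<in> U \<Longrightarrow> F differentiable (at v)"
    and orth: "\<And>v i. v \<in> U \<Longrightarrow> F v \<bullet> partial_deriv i x v = 0"
  defines "l \<equiv> F u \<bullet> n u"
  shows "n u \<bullet> (cross3 (x\<^sub>1 u) (partial_deriv 2 F u) + cross3 (partial_deriv 1 F u) (x\<^sub>2 u))
      = l * (n u \<bullet> (cross3 (x\<^sub>1 u) (n\<^sub>2 u) + cross3 (n\<^sub>1 u) (x\<^sub>2 u)))"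
    and "n u \<bullet> cross3 (partial_deriv 1 F u) (partial_deriv 2 F u) = l\<^sup>2 * (n u \<bullet> cross3 (n\<^sub>1 u) (n\<^sub>2 u))"
proof -
  define \<mu> where "\<mu> v = F v \<bullet> n v" for v
  have d: "\<mu> differentiable (at u)" unfolding \<mu>_def[abs_def]
    by (intro differentiable_inner F differentiable_n u)
  have "partial_deriv i F u = partial_deriv i (\<lambda>v. \<mu> v *\<^sub>R n v) u" for i
    unfolding \<mu>_def by (rule partial_deriv_cong[OF open_U u]) (simp add: parallel_n orth)
  then have Fi: "partial_deriv i F u = l *\<^sub>R partial_deriv i n u + partial_deriv i \<mu> u *\<^sub>R n u" for i
    using partial_deriv_scaleR[OF d differentiable_n[OF u]] by (simp add: \<mu>_def l_def)
  have triple: "n u \<bullet> cross3 y (n u) = 0" "n u \<bullet> cross3 (n u) y = 0" for y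
    by (simp_all add: dot_cross_self)
  show "n u \<bullet> (cross3 (x\<^sub>1 u) (partial_deriv 2 F u) + cross3 (partial_deriv 1 F u) (x\<^sub>2 u))
      = l * (n u \<bullet> (cross3 (x\<^sub>1 u) (n\<^sub>2 u) + cross3 (n\<^sub>1 u) (x\<^sub>2 u)))"
    by (simp add: Fi cross_add_left cross_add_right cross_mult_left cross_mult_right inner_add_right triple distrib_left)
  show "n u \<bullet> cross3 (partial_deriv 1 F u) (partial_deriv 2 F u) = l\<^sup>2 * (n u \<bullet> cross3 (n\<^sub>1 u) (n\<^sub>2 u))"
    by (simp add: Fi cross_add_left cross_add_right cross_mult_left cross_mult_right inner_add_right triple power2_eq_square)
qed

end

definition half_gradient :: "real^3^3 \<Rightarrow> real^3 \<Rightarrow> real^3 \<Rightarrow> real^3" where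
  "half_gradient A b p = A *v p + b /\<^sub>R 2"

locale quadric_patch = surface_patch U x + eigenframe A e\<^sub>1 e\<^sub>2 e\<^sub>3 a\<^sub>1 a\<^sub>2 a\<^sub>3
  for U x A e\<^sub>1 e\<^sub>2 e\<^sub>3 a\<^sub>1 a\<^sub>2 a\<^sub>3 +
  fixes b :: "real^3" and c :: real
  assumes on_quadric: "u \<in> U \<Longrightarrow> x u \<bullet> (A *v x u) + b \<bullet> x u + c = 0"
    and nonparabolic: "u \<in> U \<Longrightarrow> cross3 (n\<^sub>1 u) (n\<^sub>2 u) \<noteq> 0"
begin

abbreviation "grad u \<equiv> half_gradient A b (x u)"

lemma partial_deriv_grad:
  assumes "u \<in> U"
  shows "grad differentiable (at u)" "partial_deriv i grad u = A *v partial_deriv i x u"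
proof -
  have 1: "(\<lambda>v. A *v x v) differentiable (at u)"
    using differentiable_compose[of "(*v) A" x u] differentiable_x[OF assms]
      linear_imp_differentiable[OF matrix_vector_mul_linear] by blast
  then show "grad differentiable (at u)"
    unfolding half_gradient_def by (intro differentiable_add differentiable_const)
  have "partial_deriv i grad u = partial_deriv i (\<lambda>v. A *v x v) u"
    unfolding half_gradient_def by (subst partial_deriv_add[OF 1 differentiable_const]) simp
  then show "partial_deriv i grad u = A *v partial_deriv i x u"
    using partial_deriv_linear[OF matrix_vector_mul_bounded_linear differentiable_x[OF assms]] by simp
qed

lemma A_sym: "v \<bullet> (A *v w) = (A *v v) \<bullet> w"
  by (subst (1 2) frame_inner) (simp add: A_inner)

lemma grad_orthogonal:
  assumes "u \<in> U"
  shows "grad u \<bullet> partial_deriv i x u = 0"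
proof -
  note d = differentiable_x[OF assms] partial_deriv_grad(1)[OF assms]
  have db: "(\<lambda>v. grad v + b /\<^sub>R 2) differentiable (at u)"
    using d(2) by (intro differentiable_add) auto
  \<comment> \<open>\<open>grad v + b / 2\<close> is \<open>A x + b\<close>, so the equation of the
    quadric states that an inner product is constant.\<close>
  have "x v \<bullet> (grad v + b /\<^sub>R 2) = - c" if "v \<in> U" for v
    using on_quadric[OF that] by (simp add: half_gradient_def inner_add_right inner_commute)
  from partial_deriv_inner_zero[OF assms d(1) db this, of i]
  have "x u \<bullet> (A *v partial_deriv i x u) + (grad u + b /\<^sub>R 2) \<bullet> partial_deriv i x u = 0"
    using partial_deriv_add[OF d(2) differentiable_const] partial_deriv_grad(2)[OF assms] by (simp add: inner_commute)
  then have "2 * (grad u \<bullet> partial_deriv i x u) = 0"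
    by (simp add: half_gradient_def A_sym inner_add_left inner_add_right)
  then show ?thesis by simp
qed

text \<open>Combines \<open>normal_field\<close> for the gradient, whose derivatives are
  \<open>A x\<^sub>i\<close>, with the two frame identities for
  \<open>x\<^sub>1 \<times> x\<^sub>2\<close>.\<close>

lemma grad_forms:
  assumes u: "u \<in> U"
  defines "l \<equiv> grad u \<bullet> n u"
  shows "grad u = l *\<^sub>R n u"
    and "l\<^sup>2 * (n u \<bullet> cross3 (n\<^sub>1 u) (n\<^sub>2 u)) = norm (tangent_cross x u) * cofactor_form (n u)"
    and "l * (n u \<bullet> (cross3 (x\<^sub>1 u) (n\<^sub>2 u) + cross3 (n\<^sub>1 u) (x\<^sub>2 u))) = norm (tangent_cross x u) * cotrace_form (n u)"
  using parallel_n[OF u grad_orthogonal[OF u] grad_orthogonal[OF u]]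
    normal_field[OF u partial_deriv_grad(1) grad_orthogonal]
    cofactor_form_cross[OF tangent_cross_eq[OF u]] cotrace_form_cross[OF tangent_cross_eq[OF u]]
  by (simp_all add: l_def partial_deriv_grad(2)[OF u])

lemma forms_scaleR: "cofactor_form (l *\<^sub>R v) = l\<^sup>2 * cofactor_form v" "cotrace_form (l *\<^sub>R v) = l\<^sup>2 * cotrace_form v"
  by (simp_all add: cofactor_form_def cotrace_form_def power_mult_distrib algebra_simps)

text \<open>The Gauss curvature is \<open>cofactor_form (grad u)\<close> divided by the fourth power
  of the length of \<open>grad u\<close>.\<close>

lemma grad_cofactor:
  assumes u: "u \<in> U" and "grad u \<noteq> 0"
  shows "cofactor_form (grad u) \<noteq> 0"
proof -
  define l where "l = grad u \<bullet> n u"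
  have g: "grad u = l *\<^sub>R n u" unfolding l_def by (rule grad_forms(1)[OF u])
  then have l: "l \<noteq> 0" using assms(2) by auto
  have "n u \<bullet> cross3 (n\<^sub>1 u) (n\<^sub>2 u) \<noteq> 0"
    using cross_n12[OF u] nonparabolic[OF u] by auto
  then have "norm (tangent_cross x u) * cofactor_form (n u) \<noteq> 0"
    using l unfolding grad_forms(2)[OF u, symmetric] l_def by simp
  then show ?thesis using l unfolding g forms_scaleR by simp
qed

text \<open>Eliminates the derivatives of \<open>n\<close> between \<open>beltrami_normal\<close>
  and \<open>grad_forms\<close>. Multiplying by powers of \<open>l\<close> rather than dividing
  includes points with zero gradient.\<close>

lemma quadric_identity:
  assumes u: "u \<in> U" and rel: "beltrami_III_vec x x u = y"
  shows "cofactor_form (grad u) * (y \<bullet> grad u) = (grad u \<bullet> grad u) * cotrace_form (grad u)"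
proof -
  define l where "l = grad u \<bullet> n u"
  define \<delta> where "\<delta> = n u \<bullet> cross3 (n\<^sub>1 u) (n\<^sub>2 u)"
  define t where "t = n u \<bullet> (cross3 (x\<^sub>1 u) (n\<^sub>2 u) + cross3 (n\<^sub>1 u) (x\<^sub>2 u))"
  define m where "m = norm (tangent_cross x u)"
  have m: "m \<noteq> 0" using regular[OF u] by (simp add: m_def)
  have g: "grad u = l *\<^sub>R n u" unfolding l_def by (rule grad_forms(1)[OF u])
  have 1: "(y \<bullet> n u) * \<delta> = t"
    using beltrami_normal[OF u nonparabolic] unfolding rel \<delta>_def t_def .
  have 2: "l\<^sup>2 * \<delta> = m * cofactor_form (n u)" "l * t = m * cotrace_form (n u)"
    using grad_forms(2,3)[OF u] unfolding l_def \<delta>_def t_def m_def by simp_all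
  have "m * (cofactor_form (n u) * l * (y \<bullet> n u)) = m * (l\<^sup>2 * cotrace_form (n u))"
  proof -
    have "m * (cofactor_form (n u) * l * (y \<bullet> n u)) = l * (y \<bullet> n u) * (m * cofactor_form (n u))" by simp
    also have "\<dots> = l\<^sup>2 * (l * ((y \<bullet> n u) * \<delta>))" unfolding 2(1)[symmetric] by simp
    also have "\<dots> = m * (l\<^sup>2 * cotrace_form (n u))" unfolding 1 2(2) by simp
    finally show ?thesis .
  qed
  then have "cofactor_form (n u) * l * (y \<bullet> n u) = l\<^sup>2 * cotrace_form (n u)" using m by simp
  moreover have "grad u \<bullet> grad u = l\<^sup>2" "y \<bullet> grad u = l * (y \<bullet> n u)"
    unfolding g by (simp_all add: norm_n[OF u] power2_eq_square)
  ultimately show ?thesis unfolding g forms_scaleR by (simp add: norm_n[OF u] power2_eq_square)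
qed

text \<open>If the gradient vanished on \<open>U\<close>, a nonzero vector in the range of
  \<open>A\<close> would be a constant normal, against \<open>nonparabolic\<close>. This rules out
  double planes.\<close>

lemma grad_nonzero:
  assumes "A \<noteq> 0" "U \<noteq> {}"
  shows "\<exists>u\<in>U. grad u \<noteq> 0"
proof (rule ccontr)
  assume "\<not> ?thesis"
  then have g0: "grad v = 0" if "v \<in> U" for v using that by blast
  obtain u where u: "u \<in> U" using assms(2) by blast
  have Axi: "A *v partial_deriv i x v = 0" if "v \<in> U" for v i
    unfolding partial_deriv_grad(2)[OF that, symmetric]
    by (subst partial_deriv_cong[OF open_U that g0]) simp_all
  obtain w where w: "A *v w \<noteq> 0"
    using assms(1) by (metis matrix_eq matrix_vector_mult_0)
  have orth: "(A *v w) \<bullet> partial_deriv i x v = 0" if "v \<in> U" for v i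
    using Axi[OF that, of i] A_sym[of w "partial_deriv i x v"] by simp
  have "((A *v w) \<bullet> n u)\<^sup>2 * (n u \<bullet> cross3 (n\<^sub>1 u) (n\<^sub>2 u)) = 0"
    using normal_field(2)[OF u, of "\<lambda>_. A *v w"] orth by simp
  moreover have "(A *v w) \<bullet> n u \<noteq> 0"
    using parallel_n[OF u orth[OF u] orth[OF u]] w by auto
  moreover have "n u \<bullet> cross3 (n\<^sub>1 u) (n\<^sub>2 u) \<noteq> 0"
    using cross_n12[OF u] nonparabolic[OF u] by auto
  ultimately show False by simp
qed

end

subsection \<open>Quadrics satisfying the normal identity\<close>

lemma real_polynomial_function_zero_real:
  fixes f :: "real \<Rightarrow> real"
  assumes "real_polynomial_function f" "infinite {t. f t = 0}"
  shows "f t = 0"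
proof -
  obtain a n where f: "f = (\<lambda>x. \<Sum>i\<le>n. a i * x ^ i)"
    using real_polynomial_function_imp_sum[OF assms(1)] by blast
  then have "\<forall>i\<le>n. a i = 0"
    using polyfun_finite_roots[of a n] assms(2) by auto
  then show ?thesis by (simp add: f)
qed

text \<open>Restriction to the line from \<open>y0\<close> to \<open>y\<close> gives a polynomial in
  one variable with infinitely many zeros.\<close>

lemma real_polynomial_function_zero:
  fixes f :: "'a::real_normed_vector \<Rightarrow> real"
  assumes f: "real_polynomial_function f" and z: "\<forall>\<^sub>F y in nhds y0. f y = 0"
  shows "f y = 0"
proof -
  let ?l = "\<lambda>t::real. y0 + t *\<^sub>R (y - y0)"
  have "polynomial_function ?l"
    by (intro polynomial_function_add polynomial_function_const polynomial_function_mult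
        polynomial_function_id[unfolded id_def]
        polynomial_function_bounded_linear bounded_linear_scaleR_left)
  then have poly: "real_polynomial_function (f \<circ> ?l)"
    by (rule real_polynomial_function_compose) (rule f)
  have "(?l \<longlongrightarrow> ?l 0) (nhds 0)"
    by (intro tendsto_intros filterlim_ident)
  then have "filterlim ?l (nhds y0) (nhds 0)" by simp
  then have "\<forall>\<^sub>F t in nhds 0. f (?l t) = 0"
    by (rule eventually_compose_filterlim[OF z])
  then obtain d where d: "d > 0" "\<And>t. dist t 0 < d \<Longrightarrow> f (?l t) = 0"
    unfolding eventually_nhds_metric by blast
  have "{0<..<d} \<subseteq> {t. (f \<circ> ?l) t = 0}" using d by auto
  moreover have "infinite {0<..<d}" using d(1) by simp
  ultimately have "(f \<circ> ?l) 1 = 0"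
    using real_polynomial_function_zero_real[OF poly] infinite_super by blast
  then show ?thesis by simp
qed

text \<open>The even part in \<open>t\<close> is a polynomial in \<open>T = t\<^sup>2\<close>, which then vanishes for negative \<open>T\<close> too.\<close>

lemma even_part_zero:
  fixes f :: "real \<Rightarrow> real"
  assumes "real_polynomial_function f" "\<And>t. f (t\<^sup>2) + g t = 0" "\<And>t. g (- t) = - g t"
  shows "f T = 0"
proof (rule real_polynomial_function_zero_real[OF assms(1)])
  have "f T = 0" if "T > 0" for T
    using assms(2)[of "sqrt T"] assms(2)[of "- sqrt T"] assms(3)[of "sqrt T"] that by simp
  then have "{0<..<1} \<subseteq> {t. f t = 0}" by auto
  then show "infinite {t. f t = 0}" by (rule infinite_super) simp
qed

lemmas real_polynomial_function_intros =
  real_polynomial_function_diff real_polynomial_function_power real_polynomial_function_divide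
  real_polynomial_function.intros(2-4)
  real_polynomial_function.intros(1)[OF bounded_linear_ident]

text \<open>The algebra that remains once the surface is forgotten. Stated as an implication on a
  neighbourhood in space, the identity can be pulled back along continuous maps into the quadric
  through \<open>p\<^sub>0\<close>.\<close>

locale quadric_relation = eigenframe A e\<^sub>1 e\<^sub>2 e\<^sub>3 a\<^sub>1 a\<^sub>2 a\<^sub>3 for A e\<^sub>1 e\<^sub>2 e\<^sub>3 a\<^sub>1 a\<^sub>2 a\<^sub>3 +
  fixes b :: "real^3" and c :: real and \<Lambda> :: "real^3^3" and p\<^sub>0 :: "real^3"
  assumes p0: "p\<^sub>0 \<bullet> (A *v p\<^sub>0) + b \<bullet> p\<^sub>0 + c = 0" "cofactor_form (half_gradient A b p\<^sub>0) \<noteq> 0"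
    and identity: "\<forall>\<^sub>F p in nhds p\<^sub>0. p \<bullet> (A *v p) + b \<bullet> p + c = 0 \<longrightarrow>
      cofactor_form (half_gradient A b p) * ((\<Lambda> *v p) \<bullet> half_gradient A b p)
      = (half_gradient A b p \<bullet> half_gradient A b p) * cotrace_form (half_gradient A b p)"
begin

lemma quadric_relation_cycle: "quadric_relation A e\<^sub>2 e\<^sub>3 e\<^sub>1 a\<^sub>2 a\<^sub>3 a\<^sub>1 b c \<Lambda> p\<^sub>0"
proof -
  interpret C: eigenframe A e\<^sub>2 e\<^sub>3 e\<^sub>1 a\<^sub>2 a\<^sub>3 a\<^sub>1 by (rule cycle)
  have "C.cofactor_form = cofactor_form" "C.cotrace_form = cotrace_form"
    by (auto simp: fun_eq_iff C.cofactor_form_def cofactor_form_def C.cotrace_form_def cotrace_form_def)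
  then show ?thesis using p0 identity by unfold_locales simp_all
qed

lemma half_gradient_inner:
  "half_gradient A b p \<bullet> e\<^sub>1 = a\<^sub>1 * (p \<bullet> e\<^sub>1) + (b \<bullet> e\<^sub>1) / 2"
  "half_gradient A b p \<bullet> e\<^sub>2 = a\<^sub>2 * (p \<bullet> e\<^sub>2) + (b \<bullet> e\<^sub>2) / 2"
  "half_gradient A b p \<bullet> e\<^sub>3 = a\<^sub>3 * (p \<bullet> e\<^sub>3) + (b \<bullet> e\<^sub>3) / 2"
  by (simp_all add: half_gradient_def inner_add_left A_inner)

lemma quadric_expand:
  "p \<bullet> (A *v p) + b \<bullet> p + c = a\<^sub>1 * (p \<bullet> e\<^sub>1)\<^sup>2 + a\<^sub>2 * (p \<bullet> e\<^sub>2)\<^sup>2 + a\<^sub>3 * (p \<bullet> e\<^sub>3)\<^sup>2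
    + (b \<bullet> e\<^sub>1) * (p \<bullet> e\<^sub>1) + (b \<bullet> e\<^sub>2) * (p \<bullet> e\<^sub>2) + (b \<bullet> e\<^sub>3) * (p \<bullet> e\<^sub>3) + c"
  by (subst frame_inner[of p], subst frame_inner[of b])
    (simp add: A_inner power2_eq_square algebra_simps)

text \<open>If \<open>a\<^sub>3 = 0\<close>, the quadric is a paraboloid. Along the section \<open>p \<bullet> e\<^sub>2 = const\<close>, parametrised by
  \<open>s = p \<bullet> e\<^sub>1\<close>, the left side of the identity has degree 3 and the right side degree 4.\<close>

lemma not_paraboloid: "a\<^sub>3 \<noteq> 0"
proof
  assume a3: "a\<^sub>3 = 0"
  define \<beta> where "\<beta> = (b \<bullet> e\<^sub>3) / 2"
  \<comment> \<open>For \<open>a\<^sub>3 = 0\<close> only this term survives; its being nonzero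
    means a paraboloid with axis direction \<open>e\<^sub>3\<close>.\<close>
  have "cofactor_form (half_gradient A b p\<^sub>0) = a\<^sub>1 * a\<^sub>2 * \<beta>\<^sup>2"
    by (simp only: cofactor_form_def half_gradient_inner) (simp add: a3 \<beta>_def)
  then have nz: "a\<^sub>1 \<noteq> 0" "a\<^sub>2 \<noteq> 0" "\<beta> \<noteq> 0"
    using p0(2) by auto
  define s\<^sub>0 where "s\<^sub>0 = p\<^sub>0 \<bullet> e\<^sub>1"
  define t\<^sub>0 where "t\<^sub>0 = p\<^sub>0 \<bullet> e\<^sub>2"
  \<comment> \<open>Coefficients of the third coordinate as a quadratic in \<open>s\<close>: the
    equation of the quadric is linear in that coordinate, with factor
    \<open>2 * \<beta>\<close>.\<close>
  define z\<^sub>0 where "z\<^sub>0 = - (a\<^sub>2 * t\<^sub>0\<^sup>2 + (b \<bullet> e\<^sub>2) * t\<^sub>0 + c) / (2 * \<beta>)"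
  define z\<^sub>1 where "z\<^sub>1 = - (b \<bullet> e\<^sub>1) / (2 * \<beta>)"
  define z\<^sub>2 where "z\<^sub>2 = - a\<^sub>1 / (2 * \<beta>)"
  define P where "P s = (t\<^sub>0 *\<^sub>R e\<^sub>2 + z\<^sub>0 *\<^sub>R e\<^sub>3) + s *\<^sub>R (e\<^sub>1 + z\<^sub>1 *\<^sub>R e\<^sub>3) + s\<^sup>2 *\<^sub>R (z\<^sub>2 *\<^sub>R e\<^sub>3)" for s
  have P: "P s \<bullet> e\<^sub>1 = s" "P s \<bullet> e\<^sub>2 = t\<^sub>0" "P s \<bullet> e\<^sub>3 = z\<^sub>0 + z\<^sub>1 * s + z\<^sub>2 * s\<^sup>2" for s
    by (simp_all add: P_def inner_add_left)
  have bz: "2 * \<beta> * (z\<^sub>0 + z\<^sub>1 * s + z\<^sub>2 * s\<^sup>2) = - (a\<^sub>2 * t\<^sub>0\<^sup>2 + (b \<bullet> e\<^sub>2) * t\<^sub>0 + c) - (b \<bullet> e\<^sub>1) * s - a\<^sub>1 * s\<^sup>2" for s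
  proof -
    have "2 * \<beta> * z\<^sub>0 = - (a\<^sub>2 * t\<^sub>0\<^sup>2 + (b \<bullet> e\<^sub>2) * t\<^sub>0 + c)" "2 * \<beta> * z\<^sub>1 = - (b \<bullet> e\<^sub>1)" "2 * \<beta> * z\<^sub>2 = - a\<^sub>1"
      using nz(3) by (simp_all add: z\<^sub>0_def z\<^sub>1_def z\<^sub>2_def)
    moreover have "2 * \<beta> * (z\<^sub>0 + z\<^sub>1 * s + z\<^sub>2 * s\<^sup>2) = 2 * \<beta> * z\<^sub>0 + (2 * \<beta> * z\<^sub>1) * s + (2 * \<beta> * z\<^sub>2) * s\<^sup>2"
      by (simp add: algebra_simps)
    ultimately show ?thesis by simp
  qed
  have b3: "b \<bullet> e\<^sub>3 = 2 * \<beta>" by (simp add: \<beta>_def)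
  have onq: "P s \<bullet> (A *v P s) + b \<bullet> P s + c = 0" for s
    using bz[of s] by (simp add: quadric_expand P a3 b3)
  have "2 * \<beta> * (p\<^sub>0 \<bullet> e\<^sub>3) = 2 * \<beta> * (z\<^sub>0 + z\<^sub>1 * s\<^sub>0 + z\<^sub>2 * s\<^sub>0\<^sup>2)"
    using p0(1) unfolding quadric_expand bz by (simp add: a3 b3 s\<^sub>0_def t\<^sub>0_def)
  then have "P s\<^sub>0 = p\<^sub>0"
    using frame_expand[of "P s\<^sub>0"] frame_expand[of p\<^sub>0] nz(3) by (simp add: P s\<^sub>0_def t\<^sub>0_def)
  moreover have "(P \<longlongrightarrow> P s\<^sub>0) (nhds s\<^sub>0)"
    unfolding P_def by (intro tendsto_intros filterlim_ident)
  ultimately have "\<forall>\<^sub>F s in nhds s\<^sub>0. cofactor_form (half_gradient A b (P s)) * ((\<Lambda> *v P s) \<bullet> half_gradient A b (P s))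
      = (half_gradient A b (P s) \<bullet> half_gradient A b (P s)) * cotrace_form (half_gradient A b (P s))"
    using eventually_compose_filterlim[OF identity, of P "nhds s\<^sub>0"] by (simp add: onq)
  moreover define \<gamma> where "\<gamma> = a\<^sub>2 * t\<^sub>0 + (b \<bullet> e\<^sub>2) / 2"
  moreover define \<nu> where "\<nu> s = a\<^sub>1 * s + (b \<bullet> e\<^sub>1) / 2" for s
  moreover define L where "L i v = (\<Lambda> *v v) \<bullet> i" for i v
  moreover define l where "l s = L e\<^sub>1 (P s) * \<nu> s + L e\<^sub>2 (P s) * \<gamma> + L e\<^sub>3 (P s) * \<beta>" for s
  have LP: "L i (P s) = L i (t\<^sub>0 *\<^sub>R e\<^sub>2 + z\<^sub>0 *\<^sub>R e\<^sub>3) + s * L i (e\<^sub>1 + z\<^sub>1 *\<^sub>R e\<^sub>3) + s\<^sup>2 * L i (z\<^sub>2 *\<^sub>R e\<^sub>3)" for i s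
    unfolding L_def P_def by (simp only: matrix_vector_right_distrib matrix_vector_mult_scaleR inner_add_left inner_scaleR_left)
  have N: "half_gradient A b (P s) \<bullet> e\<^sub>1 = \<nu> s" "half_gradient A b (P s) \<bullet> e\<^sub>2 = \<gamma>" "half_gradient A b (P s) \<bullet> e\<^sub>3 = \<beta>" for s
    by (simp_all add: half_gradient_inner P a3 b3 \<nu>_def \<gamma>_def)
  define F where "F s = a\<^sub>1 * a\<^sub>2 * \<beta>\<^sup>2 * l s
      - ((\<nu> s)\<^sup>2 + \<gamma>\<^sup>2 + \<beta>\<^sup>2) * (a\<^sub>2 * (\<nu> s)\<^sup>2 + a\<^sub>1 * \<gamma>\<^sup>2 + (a\<^sub>1 + a\<^sub>2) * \<beta>\<^sup>2)" for s
  have "F s = cofactor_form (half_gradient A b (P s)) * ((\<Lambda> *v P s) \<bullet> half_gradient A b (P s))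
      - (half_gradient A b (P s) \<bullet> half_gradient A b (P s)) * cotrace_form (half_gradient A b (P s))" for s
    unfolding F_def cofactor_form_def cotrace_form_def
    by (subst (1 2) frame_inner) (simp add: N a3 l_def L_def power2_eq_square)
  ultimately have "\<forall>\<^sub>F s in nhds s\<^sub>0. F s = 0" by (auto elim!: eventually_mono)
  moreover have "real_polynomial_function F"
    unfolding F_def[abs_def] l_def LP \<nu>_def power2_eq_square
    by (intro real_polynomial_function_intros)
  ultimately have F0: "F s = 0" for s by (rule real_polynomial_function_zero[rotated])
  define u where "u i = L i (t\<^sub>0 *\<^sub>R e\<^sub>2 + z\<^sub>0 *\<^sub>R e\<^sub>3)" for i
  define v where "v i = L i (e\<^sub>1 + z\<^sub>1 *\<^sub>R e\<^sub>3)" for i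
  define w where "w i = L i (z\<^sub>2 *\<^sub>R e\<^sub>3)" for i
  \<comment> \<open>The fourth difference with step 1 annihilates cubics and gives 24 times the
    leading coefficient of a quartic, here \<open>- a\<^sub>2 * a\<^sub>1 ^ 4\<close>.\<close>
  have "F 2 - 4 * F 1 + 6 * F 0 - 4 * F (-1) + F (-2) = - 24 * (a\<^sub>2 * a\<^sub>1 ^ 4)"
    unfolding F_def l_def LP u_def[symmetric] v_def[symmetric] w_def[symmetric] \<nu>_def
    by (simp add: field_simps power2_eq_square power4_eq_xxxx)
  then show False using F0 nz by simp
qed

section \<open>Central quadrics\<close>

lemma nondegenerate: "a\<^sub>1 \<noteq> 0" "a\<^sub>2 \<noteq> 0" "a\<^sub>3 \<noteq> 0"
proof -
  interpret C: quadric_relation A e\<^sub>2 e\<^sub>3 e\<^sub>1 a\<^sub>2 a\<^sub>3 a\<^sub>1 b c \<Lambda> p\<^sub>0 by (rule quadric_relation_cycle)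
  interpret D: quadric_relation A e\<^sub>3 e\<^sub>1 e\<^sub>2 a\<^sub>3 a\<^sub>1 a\<^sub>2 b c \<Lambda> p\<^sub>0 by (rule C.quadric_relation_cycle)
  show "a\<^sub>1 \<noteq> 0" "a\<^sub>2 \<noteq> 0" "a\<^sub>3 \<noteq> 0" by (rule C.not_paraboloid D.not_paraboloid not_paraboloid)+
qed

text \<open>\<open>A\<^sub>i\<^sub>n\<^sub>v\<close> inverts \<open>A\<close>. In terms of
  half-gradients the quadric is the level \<open>k\<close> of its quadratic form;
  \<open>\<psi>\<close> rescales this level to 1, and \<open>\<kappa>\<close> is the constant value
  of \<open>cofactor_form\<close> there.\<close>

definition "A\<^sub>i\<^sub>n\<^sub>v v = ((v \<bullet> e\<^sub>1) / a\<^sub>1) *\<^sub>R e\<^sub>1 + ((v \<bullet> e\<^sub>2) / a\<^sub>2) *\<^sub>R e\<^sub>2 + ((v \<bullet> e\<^sub>3) / a\<^sub>3) *\<^sub>R e\<^sub>3"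
definition "k = A\<^sub>i\<^sub>n\<^sub>v b \<bullet> b / 4 - c"
definition "\<psi> v = (A\<^sub>i\<^sub>n\<^sub>v v \<bullet> v) / k"
definition "\<kappa> = a\<^sub>1 * a\<^sub>2 * a\<^sub>3 * k"

lemma A_inv_inner: "A\<^sub>i\<^sub>n\<^sub>v v \<bullet> e\<^sub>1 = (v \<bullet> e\<^sub>1) / a\<^sub>1" "A\<^sub>i\<^sub>n\<^sub>v v \<bullet> e\<^sub>2 = (v \<bullet> e\<^sub>2) / a\<^sub>2" "A\<^sub>i\<^sub>n\<^sub>v v \<bullet> e\<^sub>3 = (v \<bullet> e\<^sub>3) / a\<^sub>3"
  by (simp_all add: A\<^sub>i\<^sub>n\<^sub>v_def inner_add_left)

lemma A_inv_quadratic: "A\<^sub>i\<^sub>n\<^sub>v v \<bullet> v = (v \<bullet> e\<^sub>1)\<^sup>2 / a\<^sub>1 + (v \<bullet> e\<^sub>2)\<^sup>2 / a\<^sub>2 + (v \<bullet> e\<^sub>3)\<^sup>2 / a\<^sub>3"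
  by (subst frame_inner) (simp add: A_inv_inner power2_eq_square)

lemma A_inv_linear: "linear A\<^sub>i\<^sub>n\<^sub>v"
  by (rule linearI) (simp_all add: A\<^sub>i\<^sub>n\<^sub>v_def inner_add_left add_divide_distrib algebra_simps)

lemma A_inv_bounded_linear: "bounded_linear A\<^sub>i\<^sub>n\<^sub>v"
  using A_inv_linear linear_conv_bounded_linear by blast

text \<open>Completes the square in each eigendirection.\<close>

lemma quadric_eq: "p \<bullet> (A *v p) + b \<bullet> p + c = A\<^sub>i\<^sub>n\<^sub>v (half_gradient A b p) \<bullet> half_gradient A b p - k"
proof -
  have sq: "(a * y + \<beta> / 2)\<^sup>2 / a = a * y\<^sup>2 + \<beta> * y + \<beta>\<^sup>2 / a / 4" if "a \<noteq> 0" for a y \<beta> :: real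
    using that by (simp add: field_simps power2_eq_square)
  show ?thesis
    unfolding quadric_expand k_def A_inv_quadratic half_gradient_inner
      sq[OF nondegenerate(1)] sq[OF nondegenerate(2)] sq[OF nondegenerate(3)]
    by (simp add: field_simps)
qed

lemma cofactor_form_eq: "cofactor_form v = a\<^sub>1 * a\<^sub>2 * a\<^sub>3 * (A\<^sub>i\<^sub>n\<^sub>v v \<bullet> v)"
  unfolding cofactor_form_def A_inv_quadratic using nondegenerate
  by (simp add: field_simps)

text \<open>For \<open>k = 0\<close> the quadric would be a cone, where the cofactor form of the
  half-gradient vanishes, contrary to the choice of \<open>p\<^sub>0\<close>.\<close>

lemma k_nonzero: "k \<noteq> 0"
  using p0 unfolding quadric_eq cofactor_form_eq by auto

lemma half_gradient_A_inv: "half_gradient A b (A\<^sub>i\<^sub>n\<^sub>v (v - b /\<^sub>R 2)) = v"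
proof -
  have "half_gradient A b (A\<^sub>i\<^sub>n\<^sub>v (v - b /\<^sub>R 2)) - v = 0"
    using nondegenerate
    by (intro frame_zero) (simp_all add: inner_diff_left half_gradient_inner A_inv_inner)
  then show ?thesis by simp
qed

lemma A_inv_half_gradient: "A\<^sub>i\<^sub>n\<^sub>v (half_gradient A b p - b /\<^sub>R 2) = p"
proof -
  have "A\<^sub>i\<^sub>n\<^sub>v (half_gradient A b p - b /\<^sub>R 2) - p = 0"
    using nondegenerate
    by (intro frame_zero) (simp_all add: inner_diff_left half_gradient_inner A_inv_inner)
  then show ?thesis by simp
qed

text \<open>A central quadric is the image of an open cone of normal directions \<open>v\<close>, the point with
  half-gradient \<open>v / \<surd>(\<psi> v)\<close>. Clearing denominators and squaring away the root leaves a polynomial identity.\<close>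

lemma homogeneous_identity:
  "((v \<bullet> v) * cotrace_form v - \<kappa> * ((\<Lambda> *v A\<^sub>i\<^sub>n\<^sub>v v) \<bullet> v) * \<psi> v)\<^sup>2
    = \<kappa>\<^sup>2 * ((\<Lambda> *v A\<^sub>i\<^sub>n\<^sub>v (b /\<^sub>R 2)) \<bullet> v)\<^sup>2 * (\<psi> v)^3"
proof -
  define v\<^sub>0 where "v\<^sub>0 = half_gradient A b p\<^sub>0"
  define \<Phi> where "\<Phi> v = A\<^sub>i\<^sub>n\<^sub>v (v /\<^sub>R sqrt (\<psi> v) - b /\<^sub>R 2)" for v
  have psi0: "\<psi> v\<^sub>0 = 1"
    using p0(1) k_nonzero unfolding quadric_eq by (simp add: \<psi>_def v\<^sub>0_def)
  have cpsi: "(\<psi> \<longlongrightarrow> \<psi> v\<^sub>0) (nhds v\<^sub>0)"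
    unfolding \<psi>_def using k_nonzero
    by (intro tendsto_intros filterlim_ident bounded_linear.tendsto[OF A_inv_bounded_linear])
  have "(\<Phi> \<longlongrightarrow> \<Phi> v\<^sub>0) (nhds v\<^sub>0)"
    unfolding \<Phi>_def using cpsi psi0
    by (intro tendsto_intros filterlim_ident bounded_linear.tendsto[OF A_inv_bounded_linear]) auto
  moreover have "\<Phi> v\<^sub>0 = p\<^sub>0" unfolding \<Phi>_def psi0 unfolding v\<^sub>0_def real_sqrt_one inverse_1 scaleR_one by (rule A_inv_half_gradient)
  ultimately have ev: "\<forall>\<^sub>F v in nhds v\<^sub>0. \<Phi> v \<bullet> (A *v \<Phi> v) + b \<bullet> \<Phi> v + c = 0 \<longrightarrow>
      cofactor_form (half_gradient A b (\<Phi> v)) * ((\<Lambda> *v \<Phi> v) \<bullet> half_gradient A b (\<Phi> v))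
      = (half_gradient A b (\<Phi> v) \<bullet> half_gradient A b (\<Phi> v)) * cotrace_form (half_gradient A b (\<Phi> v))"
    using eventually_compose_filterlim[OF identity, of \<Phi> "nhds v\<^sub>0"] by simp
  have pos: "\<forall>\<^sub>F v in nhds v\<^sub>0. \<psi> v > 0"
    using cpsi psi0 by (intro order_tendstoD(1)) auto
  have "\<forall>\<^sub>F v in nhds v\<^sub>0. ((v \<bullet> v) * cotrace_form v - \<kappa> * ((\<Lambda> *v A\<^sub>i\<^sub>n\<^sub>v v) \<bullet> v) * \<psi> v)\<^sup>2
    - \<kappa>\<^sup>2 * ((\<Lambda> *v A\<^sub>i\<^sub>n\<^sub>v (b /\<^sub>R 2)) \<bullet> v)\<^sup>2 * (\<psi> v)^3 = 0"
    using ev pos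
  proof eventually_elim
    case (elim v)
    define s where "s = sqrt (\<psi> v)"
    define r where "r = inverse s"
    have s: "s > 0" "\<psi> v = s\<^sup>2" using elim(2) by (simp_all add: s_def)
    have g: "half_gradient A b (\<Phi> v) = r *\<^sub>R v" unfolding \<Phi>_def r_def s_def by (rule half_gradient_A_inv)
    have Phi: "\<Phi> v = r *\<^sub>R A\<^sub>i\<^sub>n\<^sub>v v - A\<^sub>i\<^sub>n\<^sub>v (b /\<^sub>R 2)"
      unfolding \<Phi>_def s_def[symmetric] r_def[symmetric]
      by (simp only: linear_diff[OF A_inv_linear] linear_cmul[OF A_inv_linear])
    have q: "A\<^sub>i\<^sub>n\<^sub>v (r *\<^sub>R v) \<bullet> (r *\<^sub>R v) = k"
    proof -
      have "A\<^sub>i\<^sub>n\<^sub>v (r *\<^sub>R v) \<bullet> (r *\<^sub>R v) = r * (r * (k * \<psi> v))"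
        using k_nonzero by (simp add: linear_cmul[OF A_inv_linear] \<psi>_def)
      then show ?thesis using s by (simp add: r_def power2_eq_square field_simps)
    qed
    have cot: "cotrace_form (r *\<^sub>R v) = r\<^sup>2 * cotrace_form v"
      by (simp add: cotrace_form_def power_mult_distrib algebra_simps)
    define X where "X = (\<Lambda> *v A\<^sub>i\<^sub>n\<^sub>v v) \<bullet> v"
    define Y where "Y = (\<Lambda> *v A\<^sub>i\<^sub>n\<^sub>v (b /\<^sub>R 2)) \<bullet> v"
    define Z where "Z = (v \<bullet> v) * cotrace_form v"
    have "\<kappa> * ((\<Lambda> *v \<Phi> v) \<bullet> (r *\<^sub>R v)) = (r *\<^sub>R v \<bullet> r *\<^sub>R v) * cotrace_form (r *\<^sub>R v)"
      using elim(1) unfolding quadric_eq g cofactor_form_eq q \<kappa>_def by simp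
    then have "\<kappa> * (r * (r * X - Y)) = r^4 * Z"
      unfolding cot Phi X_def Y_def Z_def
      by (simp add: matrix_vector_mult_diff_distrib matrix_vector_mult_scaleR inner_diff_left
          power2_eq_square power4_eq_xxxx algebra_simps)
    then have "s^4 * (\<kappa> * (r * (r * X - Y))) = s^4 * (r^4 * Z)" by simp
    moreover have "s^4 * (\<kappa> * (r * (r * X - Y))) = \<kappa> * ((s * r)\<^sup>2 * s\<^sup>2 * X - (s * r) * s^3 * Y)"
      "s^4 * (r^4 * Z) = (s * r)^4 * Z"
      by (simp_all add: power2_eq_square power3_eq_cube power4_eq_xxxx algebra_simps)
    moreover have "s * r = 1" using s(1) by (simp add: r_def)
    ultimately have "\<kappa> * (s\<^sup>2 * X - s^3 * Y) = Z" by simp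
    \<comment> \<open>The odd power of the root \<open>s\<close> now stands alone on the right;
      squaring turns it into \<open>s^6 = (\<psi> v)^3\<close>, so both sides are polynomial in
      \<open>v\<close>.\<close>
    then have "Z - \<kappa> * X * s\<^sup>2 = - \<kappa> * Y * s^3" by (simp add: algebra_simps)
    then show ?case
      unfolding X_def[symmetric] Y_def[symmetric] Z_def[symmetric] s(2)
      by (simp add: power_mult_distrib power2_eq_square power3_eq_cube)
  qed
  moreover have "real_polynomial_function (\<lambda>v. ((v \<bullet> v) * cotrace_form v - \<kappa> * ((\<Lambda> *v A\<^sub>i\<^sub>n\<^sub>v v) \<bullet> v) * \<psi> v)\<^sup>2
    - \<kappa>\<^sup>2 * ((\<Lambda> *v A\<^sub>i\<^sub>n\<^sub>v (b /\<^sub>R 2)) \<bullet> v)\<^sup>2 * (\<psi> v)^3)"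
  proof -
    have lin: "real_polynomial_function (\<lambda>v. v \<bullet> w)" "real_polynomial_function (\<lambda>v. w \<bullet> v)" for w :: "real^3"
      by (intro real_polynomial_function.intros(1) bounded_linear_inner_left bounded_linear_inner_right)+
    have quad: "real_polynomial_function (\<lambda>v. f v \<bullet> v)" if "bounded_linear f" for f :: "real^3 \<Rightarrow> real^3"
    proof -
      have flin: "real_polynomial_function (\<lambda>v. f v \<bullet> e)" for e
        using bounded_linear_compose[OF bounded_linear_inner_left that] by (rule real_polynomial_function.intros(1))
      have "real_polynomial_function (\<lambda>v. (f v \<bullet> e\<^sub>1) * (v \<bullet> e\<^sub>1) + (f v \<bullet> e\<^sub>2) * (v \<bullet> e\<^sub>2) + (f v \<bullet> e\<^sub>3) * (v \<bullet> e\<^sub>3))"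
        by (intro real_polynomial_function_intros lin flin)
      then show ?thesis by (simp add: frame_inner[symmetric])
    qed
    have "bounded_linear (\<lambda>v. \<Lambda> *v A\<^sub>i\<^sub>n\<^sub>v v)"
      by (rule bounded_linear_compose[OF matrix_vector_mul_bounded_linear A_inv_bounded_linear])
    then show ?thesis
      unfolding \<psi>_def cotrace_form_def
      by (intro real_polynomial_function_intros lin quad bounded_linear_ident A_inv_bounded_linear)
  qed
  ultimately show ?thesis using real_polynomial_function_zero by fastforce
qed

text \<open>On \<open>v = e\<^sub>1 + t e\<^sub>2\<close> with \<open>t\<^sup>2 = - a\<^sub>2 / a\<^sub>1\<close>, possibly negative, \<open>\<psi>\<close> vanishes.\<close>

lemma eigenvalues_eq: "a\<^sub>1 = a\<^sub>2"
proof (rule ccontr)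
  assume ne: "a\<^sub>1 \<noteq> a\<^sub>2"
  define L where "L v w = (\<Lambda> *v A\<^sub>i\<^sub>n\<^sub>v v) \<bullet> w" for v w
  define Y where "Y w = (\<Lambda> *v A\<^sub>i\<^sub>n\<^sub>v (b /\<^sub>R 2)) \<bullet> w" for w
  define \<psi>' where "\<psi>' T = (1 / a\<^sub>1 + T / a\<^sub>2) / k" for T
  define E where "E T = (1 + T) * ((a\<^sub>2 + a\<^sub>3) + (a\<^sub>3 + a\<^sub>1) * T) - \<kappa> * (L e\<^sub>1 e\<^sub>1 + T * L e\<^sub>2 e\<^sub>2) * \<psi>' T" for T
  define m where "m = L e\<^sub>1 e\<^sub>2 + L e\<^sub>2 e\<^sub>1"
  \<comment> \<open>\<open>f\<close> and \<open>g\<close> collect the even and the odd powers of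
    \<open>t\<close> in the homogeneous identity at \<open>e\<^sub>1 + t e\<^sub>2\<close>, with
    \<open>T = t\<^sup>2\<close> in the even part.\<close>
  define f where "f T = (E T)\<^sup>2 + T * (\<kappa> * m * \<psi>' T)\<^sup>2 - \<kappa>\<^sup>2 * ((Y e\<^sub>1)\<^sup>2 + T * (Y e\<^sub>2)\<^sup>2) * (\<psi>' T)^3" for T
  define g where "g t = t * (- 2 * E (t\<^sup>2) * \<kappa> * m * \<psi>' (t\<^sup>2) - 2 * \<kappa>\<^sup>2 * Y e\<^sub>1 * Y e\<^sub>2 * (\<psi>' (t\<^sup>2))^3)" for t
  have "f (t\<^sup>2) + g t = 0" for t
  proof -
    let ?v = "e\<^sub>1 + t *\<^sub>R e\<^sub>2"
    have "?v \<bullet> ?v = 1 + t\<^sup>2" "cotrace_form ?v = (a\<^sub>2 + a\<^sub>3) + (a\<^sub>3 + a\<^sub>1) * t\<^sup>2"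
      "\<psi> ?v = \<psi>' (t\<^sup>2)"
      unfolding \<psi>_def \<psi>'_def A_inv_quadratic
      by (simp_all add: inner_add_left inner_add_right cotrace_form_def power2_eq_square)
    moreover have "(\<Lambda> *v A\<^sub>i\<^sub>n\<^sub>v ?v) \<bullet> ?v = L e\<^sub>1 e\<^sub>1 + t * m + t\<^sup>2 * L e\<^sub>2 e\<^sub>2"
      by (simp add: L_def m_def linear_add[OF A_inv_linear] linear_cmul[OF A_inv_linear] matrix_vector_right_distrib
          matrix_vector_mult_scaleR inner_add_left inner_add_right power2_eq_square algebra_simps)
    moreover have "(\<Lambda> *v A\<^sub>i\<^sub>n\<^sub>v (b /\<^sub>R 2)) \<bullet> ?v = Y e\<^sub>1 + t * Y e\<^sub>2"
      by (simp add: Y_def inner_add_right)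
    ultimately have "((1 + t\<^sup>2) * ((a\<^sub>2 + a\<^sub>3) + (a\<^sub>3 + a\<^sub>1) * t\<^sup>2) - \<kappa> * (L e\<^sub>1 e\<^sub>1 + t * m + t\<^sup>2 * L e\<^sub>2 e\<^sub>2) * \<psi>' (t\<^sup>2))\<^sup>2
      = \<kappa>\<^sup>2 * (Y e\<^sub>1 + t * Y e\<^sub>2)\<^sup>2 * (\<psi>' (t\<^sup>2))^3"
      using homogeneous_identity[of ?v] by simp
    moreover have "(1 + t\<^sup>2) * ((a\<^sub>2 + a\<^sub>3) + (a\<^sub>3 + a\<^sub>1) * t\<^sup>2) - \<kappa> * (L e\<^sub>1 e\<^sub>1 + t * m + t\<^sup>2 * L e\<^sub>2 e\<^sub>2) * \<psi>' (t\<^sup>2)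
       = E (t\<^sup>2) - t * (\<kappa> * m * \<psi>' (t\<^sup>2))"
      by (simp add: E_def algebra_simps)
    ultimately have "(E (t\<^sup>2) - t * (\<kappa> * m * \<psi>' (t\<^sup>2)))\<^sup>2 = \<kappa>\<^sup>2 * (Y e\<^sub>1 + t * Y e\<^sub>2)\<^sup>2 * (\<psi>' (t\<^sup>2))^3" by simp
    then show ?thesis unfolding f_def g_def by algebra
  qed
  moreover have "real_polynomial_function f"
    unfolding f_def[abs_def] E_def \<psi>'_def
    by (intro real_polynomial_function_intros)
  ultimately have f0: "f (- a\<^sub>2 / a\<^sub>1) = 0"
    by (intro even_part_zero[of f g]) (simp_all add: g_def)
  \<comment> \<open>Every term with \<open>\<Lambda>\<close> or \<open>b\<close> carries a factor
    \<open>\<psi>'\<close>. What remains is the square of the first term of \<open>E\<close>, itself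
    a multiple of \<open>a\<^sub>3 (a\<^sub>1 - a\<^sub>2)\<^sup>2\<close>.\<close>
  have "\<psi>' (- a\<^sub>2 / a\<^sub>1) = 0" using nondegenerate by (simp add: \<psi>'_def)
  then have "(1 - a\<^sub>2 / a\<^sub>1) * ((a\<^sub>2 + a\<^sub>3) - (a\<^sub>3 + a\<^sub>1) * (a\<^sub>2 / a\<^sub>1)) = 0"
    using f0 by (simp add: f_def E_def)
  then have "(a\<^sub>1 - a\<^sub>2) * ((a\<^sub>2 + a\<^sub>3) * a\<^sub>1 - (a\<^sub>3 + a\<^sub>1) * a\<^sub>2) = 0"
    using nondegenerate by (auto simp: field_simps)
  then have "(a\<^sub>1 - a\<^sub>2) * (a\<^sub>3 * (a\<^sub>1 - a\<^sub>2)) = 0" by (simp add: algebra_simps)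
  then show False using ne nondegenerate by simp
qed

text \<open>With all eigenvalues equal, the homogeneous identity reduces to
  \<open>(Q v)\<^sup>2 = g (d \<bullet> v)\<^sup>2 |v|\<^sup>2\<close>. As
  \<open>|v|\<^sup>2\<close> is not a multiple of the square of a linear form, \<open>d = 0\<close>.
  Then \<open>\<Lambda> b = 0\<close> and \<open>Q b = 0\<close>, that is
  \<open>2 |b|\<^sup>2 = 0\<close>.\<close>

lemma sphere: "A *v p = a\<^sub>1 *\<^sub>R p" "b = 0"
proof -
  interpret C: quadric_relation A e\<^sub>2 e\<^sub>3 e\<^sub>1 a\<^sub>2 a\<^sub>3 a\<^sub>1 b c \<Lambda> p\<^sub>0 by (rule quadric_relation_cycle)
  have eqs: "a\<^sub>2 = a\<^sub>1" "a\<^sub>3 = a\<^sub>1" using eigenvalues_eq C.eigenvalues_eq by simp_all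
  define a where "a = a\<^sub>1"
  have a: "a \<noteq> 0" using nondegenerate by (simp add: a_def)
  show "A *v p = a\<^sub>1 *\<^sub>R p" for p
    by (subst (2) frame_expand) (simp add: A_expand eqs scaleR_add_right)
  have inv: "A\<^sub>i\<^sub>n\<^sub>v v = v /\<^sub>R a" for v
    by (subst (2) frame_expand, simp only: A\<^sub>i\<^sub>n\<^sub>v_def)
      (simp add: eqs scaleR_add_right a_def divide_inverse mult.commute)
  have cot: "cotrace_form v = 2 * a * (v \<bullet> v)" for v
    by (subst frame_inner, simp only: cotrace_form_def) (simp add: eqs a_def power2_eq_square algebra_simps)
  \<comment> \<open>This is \<open>\<Lambda> *v A\<^sub>i\<^sub>n\<^sub>v (b /\<^sub>R 2)\<close>
    for scalar \<open>A\<close>.\<close>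
  define d where "d = (\<Lambda> *v b) /\<^sub>R (2 * a)"
  define g where "g = a / k"
  have g: "g \<noteq> 0" using a k_nonzero by (simp add: g_def)
  define Q where "Q v = 2 * (v \<bullet> v) - (\<Lambda> *v v) \<bullet> v" for v
  have Q: "(Q v)\<^sup>2 = g * (d \<bullet> v)\<^sup>2 * (v \<bullet> v)" for v
  proof (cases "v = 0")
    case False
    define s where "s = v \<bullet> v"
    have s: "s \<noteq> 0" using False by (simp add: s_def)
    have "(a * s * Q v)\<^sup>2 = (a * a * a * k)\<^sup>2 * (d \<bullet> v)\<^sup>2 * (s / (a * k))^3"
    proof -
      have psi: "\<psi> v = s / (a * k)" by (simp add: \<psi>_def inv s_def field_simps)
      have kap: "\<kappa> = a * a * a * k" by (simp only: \<kappa>_def) (simp add: eqs a_def)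
      have M: "(\<Lambda> *v A\<^sub>i\<^sub>n\<^sub>v v) \<bullet> v = ((\<Lambda> *v v) \<bullet> v) / a" by (simp add: inv matrix_vector_mult_scaleR divide_inverse)
      have D: "(\<Lambda> *v A\<^sub>i\<^sub>n\<^sub>v (b /\<^sub>R 2)) \<bullet> v = d \<bullet> v"
        by (simp add: inv matrix_vector_mult_scaleR d_def)
      have "(v \<bullet> v) * cotrace_form v - \<kappa> * ((\<Lambda> *v A\<^sub>i\<^sub>n\<^sub>v v) \<bullet> v) * \<psi> v = a * s * Q v"
        unfolding psi kap M cot Q_def s_def[symmetric] using a k_nonzero by (simp add: field_simps)
      then show ?thesis using homogeneous_identity[of v] unfolding D psi kap by simp
    qed
    then have "a\<^sup>2 * s\<^sup>2 * (Q v)\<^sup>2 = a\<^sup>2 * s\<^sup>2 * (g * (d \<bullet> v)\<^sup>2 * s)"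
      using a k_nonzero by (simp add: g_def power_mult_distrib power_divide field_simps power2_eq_square power3_eq_cube)
    then show ?thesis using a s by (simp add: s_def)
  qed (simp add: Q_def)
  have d0: "d = 0"
  proof (rule ccontr)
    assume d: "d \<noteq> 0"
    then obtain z where z: "cross3 d z \<noteq> 0" using cross_basis_nonzero[of d] by blast
    \<comment> \<open>On the line \<open>d + t w\<close>, \<open>Q w = 0\<close> makes the left side
      the square of \<open>Q d + t q\<close>, while the right side has nonzero coefficients at 1 and
      \<open>t\<^sup>2\<close> but no linear term. So \<open>Q d * q = 0\<close> although neither
      factor vanishes.\<close>
    define w where "w = cross3 d z"
    define q where "q = 4 * (d \<bullet> w) - (\<Lambda> *v d) \<bullet> w - (\<Lambda> *v w) \<bullet> d"
    have dw: "d \<bullet> w = 0" by (simp add: w_def dot_cross_self)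
    have Qt: "Q (d + t *\<^sub>R w) = Q d + t * q + t\<^sup>2 * Q w" for t
      by (simp add: Q_def q_def matrix_vector_right_distrib matrix_vector_mult_scaleR inner_add_left inner_add_right
          inner_commute[of w d] power2_eq_square algebra_simps)
    have vv: "(d + t *\<^sub>R w) \<bullet> (d + t *\<^sub>R w) = d \<bullet> d + t\<^sup>2 * (w \<bullet> w)" for t
      by (simp add: inner_add_left inner_add_right inner_commute[of w d] dw power2_eq_square)
    have I: "(Q d + t * q + t\<^sup>2 * Q w)\<^sup>2 = g * (d \<bullet> d)\<^sup>2 * (d \<bullet> d + t\<^sup>2 * (w \<bullet> w))" for t
      using Q[of "d + t *\<^sub>R w"] unfolding Qt vv by (simp add: inner_add_right dw)
    have Qw: "Q w = 0" using Q[of w] by (simp add: dw)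
    have 0: "(Q d)\<^sup>2 = g * (d \<bullet> d)\<^sup>2 * (d \<bullet> d)" using I[of 0] by simp
    have 1: "(Q d + q)\<^sup>2 = (Q d - q)\<^sup>2" using I[of 1] I[of "-1"] by (simp add: Qw)
    have 2: "(Q d + q)\<^sup>2 = g * (d \<bullet> d)\<^sup>2 * (d \<bullet> d) + g * (d \<bullet> d)\<^sup>2 * (w \<bullet> w)" using I[of 1] by (simp add: Qw distrib_left)
    have "Q d * q = 0" using 1 by (simp add: power2_eq_square algebra_simps)
    moreover have "q\<^sup>2 = g * (d \<bullet> d)\<^sup>2 * (w \<bullet> w)" using 0 2 \<open>Q d * q = 0\<close> by (auto simp: power2_sum)
    ultimately show False using 0 g d z by (auto simp: w_def)
  qed
  have "d = (\<Lambda> *v b) /\<^sub>R (2 * a)" by (rule d_def)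
  then have "\<Lambda> *v b = 0" using d0 a by simp
  moreover have "Q b = 0" using Q[of b] d0 by simp
  ultimately show "b = 0" by (simp add: Q_def)
qed

end

section \<open>From the algebra back to surfaces\<close>

lemma local_param_surface_patch: "local_param S U x \<Longrightarrow> surface_patch U x"
  by unfold_locales (auto simp: local_param_def)

lemma local_param_subset: "local_param S U x \<Longrightarrow> x ` U \<subseteq> S"
  unfolding local_param_def using openin_imp_subset by fastforce

lemma open_sphere_part_relation:
  assumes "open_part S (sphere 0 r)" "r > 0"
  shows "satisfies_III_relation S (2 *\<^sub>R mat 1)"
  unfolding satisfies_III_relation_def
proof (intro allI impI ballI)
  fix U x u assume lp: "local_param S U x" and u: "u \<in> U"
  interpret surface_patch U x by (rule local_param_surface_patch[OF lp])
  have "x v \<in> sphere 0 r" if "v \<in> U" for v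
    using local_param_subset[OF lp] openin_imp_subset[OF assms(1)] that by blast
  then have "norm (x v) = r" if "v \<in> U" for v using that by simp
  from beltrami_sphere[OF u assms(2) this]
  show "beltrami_III_vec x x u = 2 *\<^sub>R mat 1 *v x u"
    by (simp add: scaleR_matrix_vector_assoc[symmetric])
qed

lemma relation_imp_sphere:
  assumes S: "regular_surface S" "no_parabolic_points S"
    and Q: "Q = {p. p \<bullet> (A *v p) + b \<bullet> p + c = 0}" "transpose A = A" "A \<noteq> 0"
    and op: "open_part S Q" and rel: "satisfies_III_relation S \<Lambda>"
  shows "\<exists>r>0. open_part S (sphere 0 r)"
proof -
  obtain e1 e2 e3 a1 a2 a3 where "eigenframe A e1 e2 e3 a1 a2 a3"
    using eigenframe_exists[OF Q(2)] .
  then interpret E: eigenframe A e1 e2 e3 a1 a2 a3 .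
  have SQ: "S \<subseteq> Q" using op by (rule openin_imp_subset)
  have patch: "quadric_patch U x A e1 e2 e3 a1 a2 a3 b c" if lp: "local_param S U x" for U x
  proof -
    interpret surface_patch U x by (rule local_param_surface_patch[OF lp])
    show ?thesis
    proof
      fix u assume u: "u \<in> U"
      show "x u \<bullet> (A *v x u) + b \<bullet> x u + c = 0"
        using local_param_subset[OF lp] SQ u unfolding Q(1) by blast
      show "cross3 (partial_deriv 1 (gauss_map x) u) (partial_deriv 2 (gauss_map x) u) \<noteq> 0"
        using gauss_curvature_zero[OF u] S(2) lp u unfolding no_parabolic_points_def by blast
    qed
  qed
  obtain U x where lp: "local_param S U x" and "U \<noteq> {}"
    using S(1) unfolding regular_surface_def by blast
  interpret P: quadric_patch U x A e1 e2 e3 a1 a2 a3 b c by (rule patch[OF lp])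
  obtain u where u: "u \<in> U" "half_gradient A b (x u) \<noteq> 0"
    using P.grad_nonzero[OF Q(3) \<open>U \<noteq> {}\<close>] by blast
  \<comment> \<open>The identity involves only the point, so any patch through \<open>p\<close>
    supplies it.\<close>
  have id: "E.cofactor_form (half_gradient A b p) * ((\<Lambda> *v p) \<bullet> half_gradient A b p)
      = (half_gradient A b p \<bullet> half_gradient A b p) * E.cotrace_form (half_gradient A b p)" if p: "p \<in> S" for p
  proof -
    obtain V y where lp': "local_param S V y" "p \<in> y ` V"
      using S(1) p unfolding regular_surface_def by blast
    then obtain v where v: "v \<in> V" "p = y v" by blast
    interpret P': quadric_patch V y A e1 e2 e3 a1 a2 a3 b c by (rule patch[OF lp'(1)])
    have "beltrami_III_vec y y v = \<Lambda> *v y v"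
      using rel lp'(1) v(1) unfolding satisfies_III_relation_def by blast
    from P'.quadric_identity[OF v(1) this] show ?thesis by (simp add: v(2))
  qed
  \<comment> \<open>\<open>S\<close> is open in \<open>Q\<close>, so near \<open>x u\<close> every
    point of the quadric lies in \<open>S\<close> and satisfies \<open>id\<close>.\<close>
  obtain T where T: "open T" "S = Q \<inter> T" using op by (auto simp: openin_open)
  have xS: "x u \<in> S" using local_param_subset[OF lp] u(1) by blast
  interpret R: quadric_relation A e1 e2 e3 a1 a2 a3 b c \<Lambda> "x u"
  proof
    show "x u \<bullet> (A *v x u) + b \<bullet> x u + c = 0" by (rule P.on_quadric[OF u(1)])
    show "E.cofactor_form (half_gradient A b (x u)) \<noteq> 0" by (rule P.grad_cofactor[OF u])
    have "\<forall>\<^sub>F p in nhds (x u). p \<in> T" using T xS by (intro eventually_nhds_in_open) auto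
    then show "\<forall>\<^sub>F p in nhds (x u). p \<bullet> (A *v p) + b \<bullet> p + c = 0 \<longrightarrow>
      E.cofactor_form (half_gradient A b p) * ((\<Lambda> *v p) \<bullet> half_gradient A b p)
      = (half_gradient A b p \<bullet> half_gradient A b p) * E.cotrace_form (half_gradient A b p)"
      by eventually_elim (use id T(2) Q(1) in blast)
  qed
  define r where "r = norm (x u)"
  \<comment> \<open>With \<open>b = 0\<close> the half-gradient is \<open>A p\<close>, so the origin
    would have zero gradient; this makes the radius positive.\<close>
  have "x u \<noteq> 0" using u(2) R.sphere(2) by (auto simp: half_gradient_def)
  then have r: "r > 0" by (simp add: r_def)
  have q: "p \<bullet> (A *v p) + b \<bullet> p + c = a1 * (norm p)\<^sup>2 + c" for p
    by (simp add: R.sphere dot_square_norm)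
  have "a1 * r\<^sup>2 + c = 0" using P.on_quadric[OF u(1)] unfolding q r_def .
  then have iff: "a1 * (norm p)\<^sup>2 + c = 0 \<longleftrightarrow> norm p = r" for p
    using R.nondegenerate(1) r
    by (metis add_right_cancel mult_left_cancel norm_ge_zero order_less_imp_le power2_eq_iff_nonneg)
  have "Q = {p. norm p = r}" by (simp only: Q(1) q iff)
  also have "\<dots> = sphere 0 r" by (simp add: set_eq_iff)
  finally have "Q = sphere 0 r" .
  then show ?thesis using op r by blast
qed

theorem proposition2:
  fixes S Q :: "(real^3) set"
  assumes "regular_surface S" and "connected S" and "no_parabolic_points S"
    and "quadric Q" and "open_part S Q"
  shows "(\<exists>\<Lambda>. satisfies_III_relation S \<Lambda>) \<longleftrightarrow> (\<exists>r>0. open_part S (sphere 0 r))"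
proof
  assume "\<exists>\<Lambda>. satisfies_III_relation S \<Lambda>"
  then show "\<exists>r>0. open_part S (sphere 0 r)"
    using relation_imp_sphere assms unfolding quadric_def by blast
next
  assume "\<exists>r>0. open_part S (sphere 0 r)"
  then show "\<exists>\<Lambda>. satisfies_III_relation S \<Lambda>"
    using open_sphere_part_relation by blast
qed

end
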